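(* Let $\mathscr T=(V,E)$ be a rooted directed tree with root $\mathsf{root}$ and let $\mathscr T_\infty$ be the extended directed tree associated with $\mathscr T$, with vertex set $V_\infty=V\sqcup\{\infty\}$. For $u\in V$ and $b\in V\setminus\{u\}$, consider a weight system $\lambda_u=\{\lambda_{uv}\}_{v\in V_\infty}$ of complex numbers and assume that the weighted join operator $W^{(b)}_{\lambda_u}$ on $\mathscr T$ belongs to $B(\ell^2(V))$. Let $D^{(b)}_{\lambda_u}$, $N^{(b)}_{\lambda_u}$, $\mathscr H^{(b)}_u=\ell^2(\mathrm{supp}\,\mathscr H^{(b)}_u)$ be the components of the orthogonal decomposition of $W^{(b)}_{\lambda_u}$ and $A_u$ the set described in the context, and let $W_u:=\{v\in\mathrm{supp}\,\mathscr H^{(b)}_u:\lambda_{uv}=\lambda_{uu}\}$. If $\ker D^{(b)}_{\lambda_u}=\{0\}$ and $N^{(b)}_{\lambda_u}\neq0$, then the following statements are equivalent: (i) $X\in B(\ell^2(V))$ belongs to the commutant $\{W^{(b)}_{\lambda_u}\}'$ of $W^{(b)}_{\lambda_u}$. (ii) $X\in B(\ell^2(V))$ admits the orthogonal decomposition $$X=\begin{bmatrix}P&f_0\otimes e_{\lambda_u,A_u}\\ e_u\otimes e_{\mu_u,W_u}&S\end{bmatrix}\quad\text{on }\ \ell^2(V)=\mathscr H^{(b)}_u\oplus(\ell^2(V)\ominus\mathscr H^{(b)}_u),$$ where $P$ is a block diagonal operator in $\{D^{(b)}_{\lambda_u}\}'$, $f_0\in\ker(D^{(b)}_{\lambda_u}-\lambda_{uu})$,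 $\mu_u:=\{\mu_{uv}\}_{v\in\mathrm{supp}\,\mathscr H^{(b)}_u}$ belongs to $\ell^2(\mathrm{supp}\,\mathscr H^{(b)}_u)$, and $S$ is any operator in $B(\ell^2(V)\ominus\mathscr H^{(b)}_u)$ such that $Se_u=\langle Se_u,e_u\rangle e_u$ and $S^*e_{\lambda_u,A_u}=\overline{\langle Se_u,e_u\rangle}\,e_{\lambda_u,A_u}$.
   Context: Trees. A directed tree $\mathscr T=(V,E)$ is a directed graph (no loops, $V$ and $E$ nonempty) which has no circuits, is connected (ignoring orientation), and in which every non-root vertex $v$ has exactly one parent $\mathsf{par}(v)$; a root is a vertex with no parent, and $\mathscr T$ is rooted if it has a unique root $\mathsf{root}$. Throughout $\mathrm{card}(V)=\aleph_0$. $\mathsf{Des}(u)\subseteq V$ is the set of descendants of $u$, including $u$; $\mathsf{Asc}(u)=\{\mathsf{par}^{\langle n\rangle}(u):n\ge1\}$. The depth of $u$ is the length of the directed path from $\mathsf{root}$ to $u$. For $v\in\mathsf{Des}(u)$, $[u,v]$ is the set of vertices of the directed path from $u$ to $v$ and $\mathsf{Des}_v(u)=\mathsf{Des}(u)\setminus[u,v]$; so $\mathsf{Des}_u(u)=\mathsf{Des}(u)\setminus\{u\}$. Join operations. The extended tree has vertex set $V_\infty=V\sqcup\{\infty\}$ with $\infty$ declared a child (hence a descendant) of every $v\in V$. For $u,v\in V_\infty$: $u\sqcup v=u$ if $u$ is a descendant of $v$; $=v$ if $v$ is a descendant of $u$; $=\infty$ otherwise. For $u,v\in V$, $u\sqcap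 v$ is the vertex of largest depth among $\{w\in V:\mathsf{par}^{\langle n\rangle}(u)=w=\mathsf{par}^{\langle m\rangle}(v)\text{ for some }m,n\ge0\}$. For $b\in V$: $u\sqcup_bv=u\sqcap v$ if $u,v\in\mathsf{Asc}(b)$; $=u$ if $v=b$; $=v$ if $u=b$; $=u\sqcup v$ otherwise. Operators. A weight system is a family $\{\lambda_{uv}\}_{v\in V_\infty}\subseteq\mathbb C$ with $\lambda_{u\infty}=0$. $W^{(b)}_{\lambda_u}$ has domain $\{f\in\ell^2(V):\Lambda^{(b)}_uf\in\ell^2(V)\}$ and $W^{(b)}_{\lambda_u}f=\Lambda^{(b)}_uf$, where $(\Lambda^{(b)}_uf)(w)=\sum_{v\in V:\,u\sqcup_bv=w}\lambda_{uv}f(v)$. $\{e_v\}$ is the standard orthonormal basis, $\ell^2(W)$ for $W\subseteq V$ is viewed as a subspace of $\ell^2(V)$, $(x\otimes y)(h)=\langle h,y\rangle x$, and $e_{\mu,A}=\sum_{v\in A}\overline{\mu_v}e_v$ for $A\subseteq V$ (so $e_{\lambda_u,A_u}=\sum_{v\in A_u}\overline{\lambda_{uv}}e_v$ and $e_{\mu_u,W_u}=\sum_{v\in W_u}\overline{\mu_{uv}}e_v$). For $b\neq u$, $W^{(b)}_{\lambda_u}=D^{(b)}_{\lambda_u}\oplus N^{(b)}_{\lambda_u}$ on $\mathscr H^{(b)}_u\oplus(\ell^2(V)\ominus\mathscr H^{(b)}_u)$, where $\mathscr H^{(b)}_u=\ell^2(\mathrm{supp}\,\mathscr H^{(b)}_u)$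 with $\mathrm{supp}\,\mathscr H^{(b)}_u=\mathsf{Asc}(u)\cup\mathsf{Des}_b(u)$ if $b\in\mathsf{Des}(u)$ and $\mathsf{Des}_u(u)$ otherwise; $D^{(b)}_{\lambda_u}$ is the diagonal operator in $\mathscr H^{(b)}_u$ with $e_v\mapsto\lambda_{uv}e_v$; $N^{(b)}_{\lambda_u}=e_u\otimes e_{\lambda_u,A_u}$ with $A_u=[u,b]$ if $b\in\mathsf{Des}(u)$ and $A_u=\mathsf{Asc}(u)\cup\{b,u\}$ otherwise. For bounded $T$, $\{T\}'=\{A\text{ bounded}:AT=TA\}$. "Block diagonal" is with respect to the decomposition of $\mathscr H^{(b)}_u$ into the eigenspaces of $D^{(b)}_{\lambda_u}$. *)

theory Defs
  imports "HOL-Analysis.Analysis"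
begin

section \<open>Rooted directed trees\<close>

text \<open>
  A directed graph is given by its vertex set V and its set E of edges (parent, child).
  With at most one parent per vertex, \<open>(w, u) \<in> E ^^ n\<close> says that the n-fold parent of u is
  defined and equals w.
\<close>

definition is_root :: "'v set \<Rightarrow> ('v \<times> 'v) set \<Rightarrow> 'v \<Rightarrow> bool" where
  "is_root V E v \<longleftrightarrow> v \<in> V \<and> (\<nexists>w. (w, v) \<in> E)"

definition directed_tree :: "'v set \<Rightarrow> ('v \<times> 'v) set \<Rightarrow> bool" where
  "directed_tree V E \<longleftrightarrow>
     V \<noteq> {} \<and> E \<noteq> {} \<and> E \<subseteq> V \<times> V \<and> irrefl E \<and> acyclic E \<and>
     (\<forall>u\<in>V. \<forall>v\<in>V. (u, v) \<in> (E \<union> E\<inverse>)\<^sup>*) \<and>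
     (\<forall>v\<in>V. \<not> is_root V E v \<longrightarrow> (\<exists>!w. (w, v) \<in> E))"

definition rooted_directed_tree :: "'v set \<Rightarrow> ('v \<times> 'v) set \<Rightarrow> bool" where
  "rooted_directed_tree V E \<longleftrightarrow> directed_tree V E \<and> (\<exists>!r. is_root V E r)"

definition root_of :: "'v set \<Rightarrow> ('v \<times> 'v) set \<Rightarrow> 'v" where
  "root_of V E = (THE r. is_root V E r)"

definition Des :: "('v \<times> 'v) set \<Rightarrow> 'v \<Rightarrow> 'v set" where
  "Des E u = {v. (u, v) \<in> E\<^sup>*}"

definition Asc :: "('v \<times> 'v) set \<Rightarrow> 'v \<Rightarrow> 'v set" where
  "Asc E u = {w. \<exists>n\<ge>1. (w, u) \<in> E ^^ n}"

definition depth :: "'v set \<Rightarrow> ('v \<times> 'v) set \<Rightarrow> 'v \<Rightarrow> nat" where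
  "depth V E u = (THE n. (root_of V E, u) \<in> E ^^ n)"

text \<open>\<open>[u,v]\<close>: directed paths in a tree are unique, so a vertex w lies on the one from u to v
  iff it is a descendant of u and an ancestor-or-self of v.\<close>

definition path_verts :: "('v \<times> 'v) set \<Rightarrow> 'v \<Rightarrow> 'v \<Rightarrow> 'v set" where
  "path_verts E u v = {w. w \<in> Des E u \<and> v \<in> Des E w}"

text \<open>\<open>Des_off E v u\<close> is \<open>Des\<^sub>v(u)\<close>.\<close>

definition Des_off :: "('v \<times> 'v) set \<Rightarrow> 'v \<Rightarrow> 'v \<Rightarrow> 'v set" where
  "Des_off E v u = Des E u - path_verts E u v"


section \<open>Join operations on the extended tree\<close>

text \<open>The vertex set of the extended tree is \<open>insert None (Some ` V)\<close>, with \<open>None\<close> as \<open>\<infinity>\<close>.\<close>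

definition ext_edges :: "'v set \<Rightarrow> ('v \<times> 'v) set \<Rightarrow> ('v option \<times> 'v option) set" where
  "ext_edges V E = {(Some u, Some v) |u v. (u, v) \<in> E} \<union> {(Some v, None) |v. v \<in> V}"

definition join :: "'v set \<Rightarrow> ('v \<times> 'v) set \<Rightarrow> 'v option \<Rightarrow> 'v option \<Rightarrow> 'v option" where
  "join V E u v =
     (if u \<in> Des (ext_edges V E) v then u
      else if v \<in> Des (ext_edges V E) u then v
      else None)"

definition meet :: "'v set \<Rightarrow> ('v \<times> 'v) set \<Rightarrow> 'v \<Rightarrow> 'v \<Rightarrow> 'v" where
  "meet V E u v =
     (ARG_MAX (depth V E) w. w \<in> V \<and> (\<exists>m n. (w, u) \<in> E ^^ n \<and> (w, v) \<in> E ^^ m))"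

definition join_at :: "'v set \<Rightarrow> ('v \<times> 'v) set \<Rightarrow> 'v \<Rightarrow> 'v option \<Rightarrow> 'v option \<Rightarrow> 'v option" where
  "join_at V E b u v =
     (if u \<in> Some ` Asc E b \<and> v \<in> Some ` Asc E b then Some (meet V E (the u) (the v))
      else if v = Some b then u
      else if u = Some b then v
      else join V E u v)"


section \<open>Square-summable families and bounded operators\<close>

text \<open>
  Elements of \<open>\<ell>\<^sup>2(W)\<close> are functions vanishing off W, so that \<open>\<ell>\<^sup>2(W)\<close> is literally a subspace of
  \<open>\<ell>\<^sup>2(V)\<close> for \<open>W \<subseteq> V\<close>.  The inner product is linear in its first argument.
  An operator on a subspace H is a HOL function of which only the values on H matter.
\<close>

definition ell2 :: "'v set \<Rightarrow> ('v \<Rightarrow> complex) set" where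
  "ell2 W = {f. (\<forall>v. v \<notin> W \<longrightarrow> f v = 0) \<and> (\<lambda>v. (cmod (f v))\<^sup>2) summable_on W}"

definition ip :: "('v \<Rightarrow> complex) \<Rightarrow> ('v \<Rightarrow> complex) \<Rightarrow> complex" where
  "ip f g = (\<Sum>\<^sub>\<infinity>v. f v * cnj (g v))"

definition l2norm :: "('v \<Rightarrow> complex) \<Rightarrow> real" where
  "l2norm f = sqrt (\<Sum>\<^sub>\<infinity>v. (cmod (f v))\<^sup>2)"

definition ominus :: "('v \<Rightarrow> complex) set \<Rightarrow> ('v \<Rightarrow> complex) set \<Rightarrow> ('v \<Rightarrow> complex) set" where
  "ominus L H = {f \<in> L. \<forall>g\<in>H. ip f g = 0}"

definition unit_vec :: "'v \<Rightarrow> 'v \<Rightarrow> complex" where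
  "unit_vec v = (\<lambda>w. if w = v then 1 else 0)"

text \<open>\<open>conj_vec \<mu> A\<close> is \<open>e\<^bsub>\<mu>,A\<^esub> = (\<Sum>v\<in>A. cnj (\<mu> v) e\<^sub>v)\<close>, given by its coordinates.\<close>

definition conj_vec :: "('v \<Rightarrow> complex) \<Rightarrow> 'v set \<Rightarrow> 'v \<Rightarrow> complex" where
  "conj_vec \<mu> A = (\<lambda>v. if v \<in> A then cnj (\<mu> v) else 0)"

definition rank_one ::
    "('v \<Rightarrow> complex) \<Rightarrow> ('v \<Rightarrow> complex) \<Rightarrow> ('v \<Rightarrow> complex) \<Rightarrow> ('v \<Rightarrow> complex)" where
  "rank_one x y h = (\<lambda>w. ip h y * x w)"

definition bounded_ops ::
    "('v \<Rightarrow> complex) set \<Rightarrow> ('v \<Rightarrow> complex) set \<Rightarrow> (('v \<Rightarrow> complex) \<Rightarrow> ('v \<Rightarrow> complex)) set" where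
  "bounded_ops H K =
     {T. (\<forall>f\<in>H. T f \<in> K) \<and>
         (\<forall>f\<in>H. \<forall>g\<in>H. T (\<lambda>v. f v + g v) = (\<lambda>v. T f v + T g v)) \<and>
         (\<forall>c. \<forall>f\<in>H. T (\<lambda>v. c * f v) = (\<lambda>v. c * T f v)) \<and>
         (\<exists>C. \<forall>f\<in>H. l2norm (T f) \<le> C * l2norm f)}"

definition commutant ::
    "('v \<Rightarrow> complex) set \<Rightarrow> (('v \<Rightarrow> complex) \<Rightarrow> ('v \<Rightarrow> complex)) \<Rightarrow>
     (('v \<Rightarrow> complex) \<Rightarrow> ('v \<Rightarrow> complex)) set" where
  "commutant H T = {A \<in> bounded_ops H H. \<forall>f\<in>H. A (T f) = T (A f)}"

text \<open>The Hilbert space adjoint of a bounded operator T on H.\<close>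

definition adjoint_on ::
    "('v \<Rightarrow> complex) set \<Rightarrow> (('v \<Rightarrow> complex) \<Rightarrow> ('v \<Rightarrow> complex)) \<Rightarrow>
     ('v \<Rightarrow> complex) \<Rightarrow> ('v \<Rightarrow> complex)" where
  "adjoint_on H T g = (THE h. h \<in> H \<and> (\<forall>f\<in>H. ip (T f) g = ip f h))"

text \<open>\<open>eigen_ker H T z\<close> is the kernel of \<open>T - z\<close> in H.\<close>

definition eigen_ker ::
    "('v \<Rightarrow> complex) set \<Rightarrow> (('v \<Rightarrow> complex) \<Rightarrow> ('v \<Rightarrow> complex)) \<Rightarrow> complex \<Rightarrow>
     ('v \<Rightarrow> complex) set" where
  "eigen_ker H T z = {f \<in> H. (\<lambda>v. T f v - z * f v) = (\<lambda>v. 0)}"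

definition op_ker ::
    "('v \<Rightarrow> complex) set \<Rightarrow> (('v \<Rightarrow> complex) \<Rightarrow> ('v \<Rightarrow> complex)) \<Rightarrow> ('v \<Rightarrow> complex) set" where
  "op_ker H T = {f \<in> H. T f = (\<lambda>v. 0)}"

definition eigenspaces ::
    "('v \<Rightarrow> complex) set \<Rightarrow> (('v \<Rightarrow> complex) \<Rightarrow> ('v \<Rightarrow> complex)) \<Rightarrow>
     ('v \<Rightarrow> complex) set set" where
  "eigenspaces H T = {K. K \<noteq> {\<lambda>v. 0} \<and> (\<exists>z. K = eigen_ker H T z)}"

text \<open>For a family of mutually orthogonal subspaces: all off-diagonal blocks of T vanish.\<close>

definition block_diagonal ::
    "('v \<Rightarrow> complex) set set \<Rightarrow> (('v \<Rightarrow> complex) \<Rightarrow> ('v \<Rightarrow> complex)) \<Rightarrow> bool" where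
  "block_diagonal \<K> T \<longleftrightarrow>
     (\<forall>K\<in>\<K>. \<forall>L\<in>\<K>. K \<noteq> L \<longrightarrow> (\<forall>f\<in>K. \<forall>g\<in>L. ip (T f) g = 0))"

text \<open>X is the block operator with rows \<open>(P, Q)\<close> and \<open>(R, S)\<close> on the sum of H and K.\<close>

definition block_matrix ::
    "('v \<Rightarrow> complex) set \<Rightarrow> ('v \<Rightarrow> complex) set \<Rightarrow>
     (('v \<Rightarrow> complex) \<Rightarrow> ('v \<Rightarrow> complex)) \<Rightarrow>
     (('v \<Rightarrow> complex) \<Rightarrow> ('v \<Rightarrow> complex)) \<Rightarrow> (('v \<Rightarrow> complex) \<Rightarrow> ('v \<Rightarrow> complex)) \<Rightarrow>
     (('v \<Rightarrow> complex) \<Rightarrow> ('v \<Rightarrow> complex)) \<Rightarrow> (('v \<Rightarrow> complex) \<Rightarrow> ('v \<Rightarrow> complex)) \<Rightarrow> bool" where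
  "block_matrix H K X P Q R S \<longleftrightarrow>
     P \<in> bounded_ops H H \<and> Q \<in> bounded_ops K H \<and>
     R \<in> bounded_ops H K \<and> S \<in> bounded_ops K K \<and>
     (\<forall>f\<in>H. \<forall>g\<in>K. X (\<lambda>v. f v + g v) = (\<lambda>v. (P f v + Q g v) + (R f v + S g v)))"


section \<open>Weighted join operators\<close>

text \<open>
  Throughout, \<open>lam :: 'v option \<Rightarrow> complex\<close> is the weight system \<open>\<lambda>\<^sub>u\<close> of the fixed vertex u.
\<close>

definition wjoin ::
    "'v set \<Rightarrow> ('v \<times> 'v) set \<Rightarrow> 'v \<Rightarrow> 'v \<Rightarrow> ('v option \<Rightarrow> complex) \<Rightarrow>
     ('v \<Rightarrow> complex) \<Rightarrow> ('v \<Rightarrow> complex)" where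
  "wjoin V E b u lam f =
     (\<lambda>w. \<Sum>\<^sub>\<infinity>v\<in>{v \<in> V. join_at V E b (Some u) (Some v) = Some w}. lam (Some v) * f v)"

definition wjoin_dom ::
    "'v set \<Rightarrow> ('v \<times> 'v) set \<Rightarrow> 'v \<Rightarrow> 'v \<Rightarrow> ('v option \<Rightarrow> complex) \<Rightarrow> ('v \<Rightarrow> complex) set" where
  "wjoin_dom V E b u lam = {f \<in> ell2 V. wjoin V E b u lam f \<in> ell2 V}"

definition suppH :: "('v \<times> 'v) set \<Rightarrow> 'v \<Rightarrow> 'v \<Rightarrow> 'v set" where
  "suppH E b u = (if b \<in> Des E u then Asc E u \<union> Des_off E b u else Des_off E u u)"

definition spaceH :: "('v \<times> 'v) set \<Rightarrow> 'v \<Rightarrow> 'v \<Rightarrow> ('v \<Rightarrow> complex) set" where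
  "spaceH E b u = ell2 (suppH E b u)"

definition setA :: "('v \<times> 'v) set \<Rightarrow> 'v \<Rightarrow> 'v \<Rightarrow> 'v set" where
  "setA E b u = (if b \<in> Des E u then path_verts E u b else Asc E u \<union> {b, u})"

definition setW :: "('v \<times> 'v) set \<Rightarrow> 'v \<Rightarrow> 'v \<Rightarrow> ('v option \<Rightarrow> complex) \<Rightarrow> 'v set" where
  "setW E b u lam = {v \<in> suppH E b u. lam (Some v) = lam (Some u)}"

text \<open>The vector \<open>e\<^bsub>\<lambda>\<^sub>u,A\<^sub>u\<^esub>\<close>.\<close>

definition vecA :: "('v \<times> 'v) set \<Rightarrow> 'v \<Rightarrow> 'v \<Rightarrow> ('v option \<Rightarrow> complex) \<Rightarrow> 'v \<Rightarrow> complex" where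
  "vecA E b u lam = conj_vec (\<lambda>v. lam (Some v)) (setA E b u)"

text \<open>
  The diagonal part acts in \<open>spaceH E b u\<close> (on all of it as soon as the weighted join operator is
  bounded), the part of rank at most one in \<open>ominus (ell2 V) (spaceH E b u)\<close>.
\<close>

definition opD :: "('v option \<Rightarrow> complex) \<Rightarrow> ('v \<Rightarrow> complex) \<Rightarrow> ('v \<Rightarrow> complex)" where
  "opD lam f = (\<lambda>v. lam (Some v) * f v)"

definition opN ::
    "('v \<times> 'v) set \<Rightarrow> 'v \<Rightarrow> 'v \<Rightarrow> ('v option \<Rightarrow> complex) \<Rightarrow>
     ('v \<Rightarrow> complex) \<Rightarrow> ('v \<Rightarrow> complex)" where
  "opN E b u lam = rank_one (unit_vec u) (vecA E b u lam)"

end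

theory Submission
  imports Defs
begin

text \<open>
  Joining with u at the base point b sends v to v itself, to u, or to infinity, according to
  whether v lies in the support set, in \<open>A\<^sub>u\<close>, or in neither (\<open>join_at_eq\<close>).  The weighted join operator
  is therefore the orthogonal sum of a diagonal operator D on \<open>\<H> = \<ell>\<^sup>2(supp)\<close> and of the operator
  \<open>N = e\<^sub>u \<otimes> a\<close>, \<open>a = e\<^bsub>\<lambda>\<^sub>u,A\<^sub>u\<^esub>\<close>, on the orthogonal complement (\<open>wjoin_eq\<close>).  The set \<open>A\<^sub>u\<close> is finite,
  because a vertex of a rooted tree has finitely many ancestors, and it contains u; so a is a vector of
  the complement and \<open>\<langle>e\<^sub>u, a\<rangle> = \<lambda>\<^sub>u\<^sub>u\<close>.

  What remains is linear algebra in \<open>\<ell>\<^sup>2\<close>, which does not refer to the tree.  A bounded operator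
  with blocks P, Q, R, S commutes with \<open>D \<oplus> N\<close> iff \<open>PD = DP\<close>, \<open>QN = DQ\<close>, \<open>RD = NR\<close> and \<open>SN = NS\<close>.
  Because D is injective and N has the one-dimensional range spanned by \<open>e\<^sub>u\<close>, the second equation
  says that \<open>Q = f\<^sub>0 \<otimes> a\<close> with \<open>f\<^sub>0\<close> in \<open>ker (D - \<lambda>\<^sub>u\<^sub>u)\<close>, the third that R maps into the span of
  \<open>e\<^sub>u\<close> and only sees basis vectors of weight \<open>\<lambda>\<^sub>u\<^sub>u\<close>, and the fourth that \<open>e\<^sub>u\<close> is an eigenvector of S
  and a is an eigenvector of its adjoint, with conjugate eigenvalues.  The two directions are
  \<open>commutant_imp_blocks\<close> and \<open>blocks_imp_commutant\<close>; block diagonality of P follows from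
  \<open>PD = DP\<close> by \<open>commuting_block_diagonal\<close>.

  Two analytic facts are used: a bounded operator on \<open>\<ell>\<^sup>2\<close> is determined by its values on the standard basis,
  and adjoints exist.  Both come from the Riesz representation of bounded functionals
  (\<open>Riesz_ell2\<close>), obtained by computing coordinates.
\<close>

section \<open>Square-summable families\<close>

text \<open>Working with sums over the whole type makes the summability condition independent of the
  carrier, so that membership in different \<open>\<ell>\<^sup>2(W)\<close> can be compared directly.\<close>

lemma ell2_iff:
  "f \<in> ell2 W \<longleftrightarrow> (\<forall>v. v \<notin> W \<longrightarrow> f v = 0) \<and> (\<lambda>v. (cmod (f v))\<^sup>2) summable_on UNIV"
proof -
  have "(\<lambda>v. (cmod (f v))\<^sup>2) summable_on W \<longleftrightarrow> (\<lambda>v. (cmod (f v))\<^sup>2) summable_on UNIV"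
    if "\<forall>v. v \<notin> W \<longrightarrow> f v = 0"
    by (rule summable_on_cong_neutral) (use that in auto)
  then show ?thesis
    unfolding ell2_def by auto
qed

lemma ell2_outside: "f \<in> ell2 W \<Longrightarrow> v \<notin> W \<Longrightarrow> f v = 0"
  by (auto simp: ell2_iff)

lemma ell2_summable: "f \<in> ell2 W \<Longrightarrow> (\<lambda>v. (cmod (f v))\<^sup>2) summable_on UNIV"
  by (simp add: ell2_iff)

lemma ell2_mono: "f \<in> ell2 W \<Longrightarrow> W \<subseteq> W' \<Longrightarrow> f \<in> ell2 W'"
  by (auto simp: ell2_iff)

lemma ell2_dominated:
  assumes "f \<in> ell2 W" and "\<And>v. cmod (g v) \<le> cmod (f v)"
  shows "g \<in> ell2 W"
proof -
  have "(\<lambda>v. (cmod (g v))\<^sup>2) summable_on UNIV"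
    by (rule summable_on_comparison_test[OF ell2_summable[OF assms(1)]])
      (auto intro: power_mono assms(2))
  moreover have "g v = 0" if "v \<notin> W" for v
    using assms(2)[of v] ell2_outside[OF assms(1) that] by simp
  ultimately show ?thesis by (simp add: ell2_iff)
qed

lemma ell2_scale: "f \<in> ell2 W \<Longrightarrow> (\<lambda>v. c * f v) \<in> ell2 W"
  by (auto simp: ell2_iff norm_mult power_mult_distrib intro: summable_on_cmult_right)

lemma ell2_cnj: "f \<in> ell2 W \<Longrightarrow> (\<lambda>v. cnj (f v)) \<in> ell2 W"
  by (simp add: ell2_iff)

lemma ell2_add:
  assumes f: "f \<in> ell2 W" and g: "g \<in> ell2 W"
  shows "(\<lambda>v. f v + g v) \<in> ell2 W"
proof -
  have "(\<lambda>v. 2 * (cmod (f v))\<^sup>2 + 2 * (cmod (g v))\<^sup>2) summable_on UNIV"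
    by (intro summable_on_add summable_on_cmult_right ell2_summable[OF f] ell2_summable[OF g])
  moreover have "(cmod (f v + g v))\<^sup>2 \<le> 2 * (cmod (f v))\<^sup>2 + 2 * (cmod (g v))\<^sup>2" for v
  proof -
    have "(cmod (f v + g v))\<^sup>2 \<le> (cmod (f v) + cmod (g v))\<^sup>2"
      by (intro power_mono norm_triangle_ineq) auto
    also have "\<dots> \<le> 2 * (cmod (f v))\<^sup>2 + 2 * (cmod (g v))\<^sup>2"
      using sum_squares_bound[of "cmod (f v)" "cmod (g v)"] by (simp add: power2_sum)
    finally show ?thesis .
  qed
  ultimately have "(\<lambda>v. (cmod (f v + g v))\<^sup>2) summable_on UNIV"
    by (rule summable_on_comparison_test) auto
  then show ?thesis
    using f g by (auto simp: ell2_iff)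
qed

lemma ell2_diff:
  assumes "f \<in> ell2 W" and "g \<in> ell2 W"
  shows "(\<lambda>v. f v - g v) \<in> ell2 W"
  using ell2_add[OF assms(1) ell2_scale[OF assms(2), of "-1"]] by simp

lemma ell2_finite:
  assumes "finite F" "F \<subseteq> W" and "\<And>v. v \<notin> F \<Longrightarrow> f v = 0"
  shows "f \<in> ell2 W"
proof -
  have "(\<lambda>v. (cmod (f v))\<^sup>2) summable_on F"
    using assms(1) by (rule summable_on_finite)
  then have "f \<in> ell2 F"
    using assms(3) by (auto simp: ell2_def)
  then show ?thesis
    using assms(2) ell2_mono by blast
qed

lemma unit_vec_ell2: "v \<in> W \<Longrightarrow> unit_vec v \<in> ell2 W"
  by (rule ell2_finite[of "{v}"]) (auto simp: unit_vec_def)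

definition restr :: "'v set \<Rightarrow> ('v \<Rightarrow> complex) \<Rightarrow> 'v \<Rightarrow> complex" where
  "restr W f = (\<lambda>v. if v \<in> W then f v else 0)"

lemma restr_ell2:
  assumes "f \<in> ell2 V"
  shows "restr W f \<in> ell2 W"
proof -
  have "restr W f \<in> ell2 V"
    by (rule ell2_dominated[OF assms]) (simp add: restr_def)
  then have "(\<lambda>v. (cmod (restr W f v))\<^sup>2) summable_on UNIV"
    by (rule ell2_summable)
  then show ?thesis
    by (simp add: ell2_iff) (simp add: restr_def)
qed

lemma restr_ell2_finite: "finite F \<Longrightarrow> F \<subseteq> W \<Longrightarrow> restr F f \<in> ell2 W"
  by (rule ell2_finite[of F]) (auto simp: restr_def)

lemma restr_id: "f \<in> ell2 W \<Longrightarrow> restr W f = f"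
  by (auto simp: restr_def ell2_iff)

lemma l2norm_nonneg: "0 \<le> l2norm f"
  unfolding l2norm_def by (intro real_sqrt_ge_zero infsum_nonneg) auto

lemma l2norm_mono:
  assumes "f \<in> ell2 W" and "\<And>v. cmod (g v) \<le> cmod (f v)"
  shows "l2norm g \<le> l2norm f"
  unfolding l2norm_def
  by (intro real_sqrt_le_mono infsum_mono ell2_summable[OF assms(1)]
      ell2_summable[OF ell2_dominated[OF assms]] power_mono assms(2)) auto

lemma l2norm_restr: "f \<in> ell2 V \<Longrightarrow> l2norm (restr W f) \<le> l2norm f"
  by (rule l2norm_mono) (auto simp: restr_def)

lemma l2norm_scale: "l2norm (\<lambda>v. c * f v) = cmod c * l2norm f"
  unfolding l2norm_def
  by (simp add: norm_mult power_mult_distrib infsum_cmult_right' real_sqrt_mult)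

lemma l2norm_finite:
  assumes "finite F" and "\<And>v. v \<notin> F \<Longrightarrow> f v = 0"
  shows "l2norm f = sqrt (\<Sum>v\<in>F. (cmod (f v))\<^sup>2)"
proof -
  have "(\<Sum>\<^sub>\<infinity>v. (cmod (f v))\<^sup>2) = (\<Sum>\<^sub>\<infinity>v\<in>F. (cmod (f v))\<^sup>2)"
    by (rule infsum_cong_neutral) (use assms in auto)
  then show ?thesis
    using assms(1) by (simp add: l2norm_def)
qed

lemma sum_le_l2norm:
  assumes "f \<in> ell2 W" and "finite F"
  shows "sqrt (\<Sum>v\<in>F. (cmod (f v))\<^sup>2) \<le> l2norm f"
  unfolding l2norm_def
  by (intro real_sqrt_le_mono finite_sum_le_infsum ell2_summable[OF assms(1)] assms(2)) auto

lemma cmod_le_l2norm: "f \<in> ell2 W \<Longrightarrow> cmod (f v) \<le> l2norm f"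
  using sum_le_l2norm[of f W "{v}"] by simp

text \<open>Cauchy--Schwarz on finite sets with a bound independent of the set; it yields both the
  convergence of the inner product and the inequality for it.\<close>

lemma sum_mult_le_l2norm:
  assumes f: "f \<in> ell2 W" and g: "g \<in> ell2 W'" and "finite F"
  shows "(\<Sum>v\<in>F. cmod (f v * cnj (g v))) \<le> l2norm f * l2norm g"
proof -
  have "(\<Sum>v\<in>F. cmod (f v * cnj (g v))) \<le> L2_set (\<lambda>v. cmod (f v)) F * L2_set (\<lambda>v. cmod (g v)) F"
    using L2_set_mult_ineq[of "\<lambda>v. cmod (f v)" "\<lambda>v. cmod (g v)" F] by (simp add: norm_mult)
  also have "\<dots> \<le> l2norm f * l2norm g"
    unfolding L2_set_def
    by (intro mult_mono sum_le_l2norm[OF f] sum_le_l2norm[OF g] assms(3) l2norm_nonneg)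
      (auto intro: sum_nonneg)
  finally show ?thesis .
qed

lemma ip_abs_summable:
  assumes f: "f \<in> ell2 W" and g: "g \<in> ell2 W'"
  shows "(\<lambda>v. cmod (f v * cnj (g v))) summable_on UNIV"
proof (rule nonneg_bdd_above_summable_on)
  show "bdd_above (sum (\<lambda>v. cmod (f v * cnj (g v))) ` {F. F \<subseteq> UNIV \<and> finite F})"
    by (rule bdd_aboveI[of _ "l2norm f * l2norm g"]) (auto intro: sum_mult_le_l2norm[OF f g])
qed auto

lemma ip_summable:
  "f \<in> ell2 W \<Longrightarrow> g \<in> ell2 W' \<Longrightarrow> (\<lambda>v. f v * cnj (g v)) summable_on UNIV"
  by (rule abs_summable_summable) (rule ip_abs_summable)

lemma Cauchy_Schwarz_ip:
  assumes f: "f \<in> ell2 W" and g: "g \<in> ell2 W'"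
  shows "cmod (ip f g) \<le> l2norm f * l2norm g"
proof -
  have "cmod (ip f g) \<le> (\<Sum>\<^sub>\<infinity>v. cmod (f v * cnj (g v)))"
    unfolding ip_def by (rule norm_infsum_bound[OF ip_abs_summable[OF f g]])
  also have "\<dots> \<le> l2norm f * l2norm g"
    by (rule infsum_le_finite_sums[OF ip_abs_summable[OF f g]]) (rule sum_mult_le_l2norm[OF f g])
  finally show ?thesis .
qed

lemma ip_add_left:
  assumes "f \<in> ell2 W" "g \<in> ell2 W'" "h \<in> ell2 W''"
  shows "ip (\<lambda>v. f v + g v) h = ip f h + ip g h"
  unfolding ip_def
  using infsum_add[OF ip_summable[OF assms(1,3)] ip_summable[OF assms(2,3)]]
  by (simp add: algebra_simps)

lemma ip_scale_left: "ip (\<lambda>v. c * f v) h = c * ip f h"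
  unfolding ip_def by (simp add: mult.assoc infsum_cmult_right')

lemma ip_scale_right: "ip f (\<lambda>v. c * h v) = cnj c * ip f h"
  unfolding ip_def by (simp add: mult.left_commute infsum_cmult_right')

lemma ip_finite:
  assumes "finite F" and "\<And>v. v \<notin> F \<Longrightarrow> f v * cnj (g v) = 0"
  shows "ip f g = (\<Sum>v\<in>F. f v * cnj (g v))"
proof -
  have "ip f g = (\<Sum>\<^sub>\<infinity>v\<in>F. f v * cnj (g v))"
    unfolding ip_def by (rule infsum_cong_neutral) (use assms in auto)
  then show ?thesis
    using assms(1) by simp
qed

lemma ip_unit_right: "ip f (unit_vec v) = f v"
  by (subst ip_finite[of "{v}"]) (auto simp: unit_vec_def)

lemma ip_unit_left: "ip (unit_vec v) g = cnj (g v)"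
  by (subst ip_finite[of "{v}"]) (auto simp: unit_vec_def)

lemma ip_cong: "(\<And>v. f v * cnj (g v) = f' v * cnj (g' v)) \<Longrightarrow> ip f g = ip f' g'"
  by (simp add: ip_def)

lemma ip_eq_0: "(\<And>v. f v * cnj (g v) = 0) \<Longrightarrow> ip f g = 0"
  by (simp only: ip_def infsum_0_simp)

lemma ip_self_ne_0:
  assumes "f \<in> ell2 W" and "f \<noteq> (\<lambda>v. 0)"
  shows "ip f f \<noteq> 0"
proof
  assume 0: "ip f f = 0"
  obtain v where v: "f v \<noteq> 0"
    using assms(2) by auto
  have "ip f f = of_real (\<Sum>\<^sub>\<infinity>v. (cmod (f v))\<^sup>2)"
    unfolding ip_def complex_norm_square[symmetric]
    by (intro infsumI has_sum_of_real has_sum_infsum ell2_summable[OF assms(1)])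
  then have "(\<Sum>\<^sub>\<infinity>v. (cmod (f v))\<^sup>2) = 0"
    using 0 by simp
  then have "cmod (f v) \<le> 0"
    using cmod_le_l2norm[OF assms(1), of v] by (simp add: l2norm_def)
  then show False
    using v by simp
qed

text \<open>A vector orthogonal to all \<open>unit_vec v\<close> with \<open>v \<in> D\<close> vanishes on D.\<close>

lemma ominus_ell2:
  assumes "D \<subseteq> V"
  shows "ominus (ell2 V) (ell2 D) = ell2 (V - D)"
proof (intro equalityI subsetI)
  fix f assume f: "f \<in> ominus (ell2 V) (ell2 D)"
  have "f v = 0" if "v \<in> D" for v
    using f unit_vec_ell2[OF that] ip_unit_right[of f v] by (auto simp: ominus_def)
  then show "f \<in> ell2 (V - D)"
    using f by (auto simp: ominus_def ell2_iff)
next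
  fix f assume f: "f \<in> ell2 (V - D)"
  have "ip f g = 0" if "g \<in> ell2 D" for g
    by (rule ip_eq_0) (use f that in \<open>auto simp: ell2_iff\<close>)
  then show "f \<in> ominus (ell2 V) (ell2 D)"
    using f ell2_mono[OF f, of V] by (auto simp: ominus_def)
qed

section \<open>Bounded functionals on square-summable families\<close>

lemma ell2_finite_approx:
  assumes f: "f \<in> ell2 W" and "0 < \<epsilon>"
  obtains F where "finite F" "F \<subseteq> W" "l2norm (\<lambda>v. f v - restr F f v) < \<epsilon>"
proof -
  let ?q = "\<lambda>v. (cmod (f v))\<^sup>2"
  have q: "?q summable_on W"
    using f by (simp add: ell2_def)
  have "((\<lambda>F. sum ?q F) \<longlongrightarrow> infsum ?q W) (finite_subsets_at_top W)"
    using has_sum_infsum[OF q] by (simp add: has_sum_def)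
  then have "\<forall>\<^sub>F F in finite_subsets_at_top W. dist (sum ?q F) (infsum ?q W) < \<epsilon>\<^sup>2"
    using assms(2) by (intro tendstoD) auto
  then obtain F where F: "finite F" "F \<subseteq> W" "dist (sum ?q F) (infsum ?q W) < \<epsilon>\<^sup>2"
    unfolding eventually_finite_subsets_at_top by blast
  have "(\<Sum>\<^sub>\<infinity>v. (cmod (f v - restr F f v))\<^sup>2) = infsum ?q (W - F)"
    by (rule infsum_cong_neutral) (use f F in \<open>auto simp: restr_def ell2_iff\<close>)
  also have "\<dots> = infsum ?q W - sum ?q F"
    using F q by (subst infsum_Diff) auto
  also have "\<dots> < \<epsilon>\<^sup>2"
    using F(3) by (simp add: dist_real_def)
  finally have "l2norm (\<lambda>v. f v - restr F f v) < sqrt (\<epsilon>\<^sup>2)"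
    unfolding l2norm_def by (rule real_sqrt_less_mono)
  then show ?thesis
    using that F assms(2) by simp
qed

text \<open>The representing vector must have the coordinates \<open>cnj (\<phi> (unit_vec v))\<close>.  Boundedness forces
  it to be square-summable, since each finite section h of it satisfies
  \<open>\<parallel>h\<parallel>\<^sup>2 = \<phi> h \<le> C \<parallel>h\<parallel>\<close>; the representation holds on finitely supported vectors by linearity and
  everywhere by their density.\<close>

lemma Riesz_ell2:
  fixes \<phi> :: "('v \<Rightarrow> complex) \<Rightarrow> complex"
  assumes add: "\<And>f g. f \<in> ell2 W \<Longrightarrow> g \<in> ell2 W \<Longrightarrow> \<phi> (\<lambda>v. f v + g v) = \<phi> f + \<phi> g"
    and scale: "\<And>c f. f \<in> ell2 W \<Longrightarrow> \<phi> (\<lambda>v. c * f v) = c * \<phi> f"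
    and bound: "\<And>f. f \<in> ell2 W \<Longrightarrow> cmod (\<phi> f) \<le> C * l2norm f"
  obtains h where "h \<in> ell2 W" "\<And>f. f \<in> ell2 W \<Longrightarrow> \<phi> f = ip f h"
proof -
  define h where "h = restr W (\<lambda>v. cnj (\<phi> (unit_vec v)))"
  have fin: "\<phi> (restr F f) = (\<Sum>v\<in>F. f v * cnj (h v))" if "finite F" "F \<subseteq> W" for F f
    using that
  proof (induction F)
    case empty
    have "(\<lambda>v. 0) \<in> ell2 W" by (simp add: ell2_iff)
    from scale[OF this, of 0] show ?case by (simp add: restr_def)
  next
    case (insert x F)
    have split: "restr (insert x F) f = (\<lambda>v. f x * unit_vec x v + restr F f v)"
      using insert.hyps by (auto simp: restr_def unit_vec_def)
    have "(\<lambda>v. f x * unit_vec x v) \<in> ell2 W" "restr F f \<in> ell2 W"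
      using insert.prems insert.hyps by (auto intro!: unit_vec_ell2 ell2_scale restr_ell2_finite)
    then have "\<phi> (restr (insert x F) f) = \<phi> (\<lambda>v. f x * unit_vec x v) + \<phi> (restr F f)"
      unfolding split by (rule add)
    then have "\<phi> (restr (insert x F) f) = f x * \<phi> (unit_vec x) + \<phi> (restr F f)"
      using insert.prems by (simp add: scale unit_vec_ell2)
    then show ?case
      using insert by (simp add: h_def restr_def)
  qed
  have "(\<Sum>v\<in>F. (cmod (h v))\<^sup>2) \<le> C\<^sup>2" if F: "finite F" "F \<subseteq> W" for F
  proof -
    define s where "s = (\<Sum>v\<in>F. (cmod (h v))\<^sup>2)"
    have s0: "0 \<le> s" by (simp add: s_def sum_nonneg)
    \<comment> \<open>Testing \<open>\<phi>\<close> on the finite section of h itself gives the squared norm of that section.\<close>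
    have "\<phi> (restr F h) = of_real s"
      unfolding fin[OF F] s_def by (simp only: complex_norm_square of_real_sum)
    moreover have "l2norm (restr F h) = sqrt s"
      using F l2norm_finite[of F "restr F h"] by (simp add: restr_def s_def)
    ultimately have "sqrt s * sqrt s \<le> C * sqrt s"
      using bound[OF restr_ell2_finite[OF F, of h]] s0 by simp
    then have "sqrt s \<le> \<bar>C\<bar>"
      using s0 mult_right_le_imp_le[of "sqrt s" "sqrt s" C] by (cases "s = 0") auto
    then have "(sqrt s)\<^sup>2 \<le> \<bar>C\<bar>\<^sup>2"
      using s0 by (intro power_mono) auto
    then show ?thesis
      using s0 by (simp add: s_def)
  qed
  then have "(\<lambda>v. (cmod (h v))\<^sup>2) summable_on W"
    by (intro nonneg_bdd_above_summable_on bdd_aboveI[of _ "C\<^sup>2"]) auto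
  then have h: "h \<in> ell2 W"
    by (simp add: ell2_def h_def restr_def)
  have "\<phi> f = ip f h" if f: "f \<in> ell2 W" for f
  proof (rule ccontr)
    assume ne: "\<phi> f \<noteq> ip f h"
    define M where "M = \<bar>C\<bar> + l2norm h + 1"
    have M: "0 < M" using l2norm_nonneg[of h] by (simp add: M_def)
    define \<delta> where "\<delta> = cmod (\<phi> f - ip f h) / M"
    have "0 < \<delta>" using ne M by (simp add: \<delta>_def)
    then obtain F where F: "finite F" "F \<subseteq> W" and small: "l2norm (\<lambda>v. f v - restr F f v) < \<delta>"
      using ell2_finite_approx[OF f] by blast
    let ?t = "\<lambda>v. f v - restr F f v"
    have r: "restr F f \<in> ell2 W" by (rule restr_ell2_finite[OF F])
    have t: "?t \<in> ell2 W" by (rule ell2_diff[OF f r])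
    have "\<phi> f = \<phi> ?t + \<phi> (restr F f)"
      using add[OF t r] by simp
    moreover have "ip f h = ip ?t h + ip (restr F f) h"
      using ip_add_left[OF t r h] by simp
    moreover have "ip (restr F f) h = \<phi> (restr F f)"
      using fin[OF F, of f] F by (subst ip_finite[of F]) (auto simp: restr_def)
    ultimately have "\<phi> f - ip f h = \<phi> ?t - ip ?t h" by simp
    then have "cmod (\<phi> f - ip f h) \<le> cmod (\<phi> ?t) + cmod (ip ?t h)"
      by (simp add: norm_triangle_ineq4)
    also have "\<dots> \<le> \<bar>C\<bar> * l2norm ?t + l2norm ?t * l2norm h"
      using bound[OF t] Cauchy_Schwarz_ip[OF t h]
        mult_right_mono[OF abs_ge_self[of C] l2norm_nonneg[of ?t]] by linarith
    also have "\<dots> \<le> M * l2norm ?t"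
      using l2norm_nonneg[of ?t] by (simp add: M_def algebra_simps)
    also have "\<dots> < M * \<delta>"
      using small M by simp
    also have "\<dots> = cmod (\<phi> f - ip f h)"
      using M by (simp add: \<delta>_def)
    finally show False by simp
  qed
  with h that show ?thesis by blast
qed

section \<open>Bounded operators and block matrices\<close>

lemma bounded_ops_maps: "T \<in> bounded_ops H K \<Longrightarrow> f \<in> H \<Longrightarrow> T f \<in> K"
  by (simp add: bounded_ops_def)

lemma bounded_ops_add:
  "T \<in> bounded_ops H K \<Longrightarrow> f \<in> H \<Longrightarrow> g \<in> H \<Longrightarrow> T (\<lambda>v. f v + g v) = (\<lambda>v. T f v + T g v)"
  by (simp add: bounded_ops_def)

lemma bounded_ops_scale:
  "T \<in> bounded_ops H K \<Longrightarrow> f \<in> H \<Longrightarrow> T (\<lambda>v. c * f v) = (\<lambda>v. c * T f v)"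
  by (simp add: bounded_ops_def)

lemma bounded_ops_bound:
  assumes "T \<in> bounded_ops H K"
  obtains C where "\<And>f. f \<in> H \<Longrightarrow> l2norm (T f) \<le> C * l2norm f"
  using assms unfolding bounded_ops_def by blast

text \<open>The source of the diagonal blocks of a block matrix; with \<open>U = UNIV\<close> it only restricts
  the domain.\<close>

lemma bounded_ops_compress:
  assumes X: "X \<in> bounded_ops (ell2 V) (ell2 V)" and "D \<subseteq> V"
  shows "(\<lambda>f. restr U (X f)) \<in> bounded_ops (ell2 D) (ell2 U)"
proof -
  have sub: "f \<in> ell2 V" if "f \<in> ell2 D" for f
    using that assms(2) by (rule ell2_mono)
  obtain C where C: "\<And>f. f \<in> ell2 V \<Longrightarrow> l2norm (X f) \<le> C * l2norm f"
    using bounded_ops_bound[OF X] by metis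
  have "l2norm (restr U (X f)) \<le> C * l2norm f" if "f \<in> ell2 D" for f
    using l2norm_restr[OF bounded_ops_maps[OF X sub[OF that]], of U] C[OF sub[OF that]]
    by (rule order_trans)
  moreover have "restr U (X f) \<in> ell2 U" if "f \<in> ell2 D" for f
    by (rule restr_ell2[OF bounded_ops_maps[OF X sub[OF that]]])
  ultimately show ?thesis
    unfolding bounded_ops_def
    by (auto simp: restr_def bounded_ops_add[OF X] bounded_ops_scale[OF X] sub)
qed

lemma rank_one_bounded:
  assumes x: "x \<in> ell2 U" and y: "y \<in> ell2 U'"
  shows "rank_one x y \<in> bounded_ops (ell2 D) (ell2 U)"
proof -
  have "l2norm (rank_one x y f) \<le> (l2norm x * l2norm y) * l2norm f" if "f \<in> ell2 D" for f
  proof -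
    have "l2norm (rank_one x y f) = cmod (ip f y) * l2norm x"
      by (simp only: rank_one_def l2norm_scale)
    also have "\<dots> \<le> (l2norm f * l2norm y) * l2norm x"
      by (rule mult_right_mono[OF Cauchy_Schwarz_ip[OF that y] l2norm_nonneg])
    finally show ?thesis by (simp add: mult_ac)
  qed
  moreover have "rank_one x y f \<in> ell2 U" for f
    unfolding rank_one_def by (rule ell2_scale[OF x])
  moreover have "rank_one x y (\<lambda>v. f v + g v) = (\<lambda>v. rank_one x y f v + rank_one x y g v)"
    if "f \<in> ell2 D" "g \<in> ell2 D" for f g
    by (simp add: rank_one_def ip_add_left[OF that y] distrib_right)
  moreover have "rank_one x y (\<lambda>v. c * f v) = (\<lambda>v. c * rank_one x y f v)" for c f
    by (simp add: rank_one_def ip_scale_left mult.assoc)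
  ultimately show ?thesis
    unfolding bounded_ops_def by blast
qed

text \<open>This is the value at y of the adjoint.\<close>

lemma Riesz_bounded_op:
  assumes T: "T \<in> bounded_ops (ell2 U) (ell2 U')" and y: "y \<in> ell2 U''"
  obtains h where "h \<in> ell2 U" "\<And>f. f \<in> ell2 U \<Longrightarrow> ip (T f) y = ip f h"
proof -
  obtain C where C: "\<And>f. f \<in> ell2 U \<Longrightarrow> l2norm (T f) \<le> C * l2norm f"
    using bounded_ops_bound[OF T] by metis
  have bound: "cmod (ip (T f) y) \<le> (C * l2norm y) * l2norm f" if f: "f \<in> ell2 U" for f
    using Cauchy_Schwarz_ip[OF bounded_ops_maps[OF T f] y]
      mult_right_mono[OF C[OF f] l2norm_nonneg[of y]]
    by (simp add: mult_ac)
  show ?thesis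
  proof (rule Riesz_ell2[of U "\<lambda>f. ip (T f) y" "C * l2norm y"])
    fix f g assume "f \<in> ell2 U" "g \<in> ell2 U"
    then show "ip (T (\<lambda>v. f v + g v)) y = ip (T f) y + ip (T g) y"
      by (simp add: bounded_ops_add[OF T] ip_add_left[OF bounded_ops_maps[OF T] bounded_ops_maps[OF T] y])
  next
    fix c f assume "f \<in> ell2 U"
    then show "ip (T (\<lambda>v. c * f v)) y = c * ip (T f) y"
      by (simp add: bounded_ops_scale[OF T] ip_scale_left)
  qed (use bound that in blast)+
qed

lemma ell2_eqI:
  assumes "h \<in> ell2 U" "h' \<in> ell2 U" and "\<And>v. v \<in> U \<Longrightarrow> ip (unit_vec v) h = ip (unit_vec v) h'"
  shows "h = h'"
  using assms by (fastforce simp: ip_unit_left ell2_iff)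

text \<open>The adjoint is given by a definite description, whose existence part is the Riesz
  representation; hence an equation about the adjoint can be traded for one about inner products
  in both directions.\<close>

lemma adjoint_on_eq_iff:
  assumes S: "S \<in> bounded_ops (ell2 U) (ell2 U)" and y: "y \<in> ell2 U'" and k: "k \<in> ell2 U"
  shows "adjoint_on (ell2 U) S y = k \<longleftrightarrow> (\<forall>f\<in>ell2 U. ip (S f) y = ip f k)"
proof -
  obtain h where h: "h \<in> ell2 U" and eq: "\<And>f. f \<in> ell2 U \<Longrightarrow> ip (S f) y = ip f h"
    using Riesz_bounded_op[OF S y] by blast
  have uniq: "h' = h" if "h' \<in> ell2 U" "\<forall>f\<in>ell2 U. ip (S f) y = ip f h'" for h'
    by (rule ell2_eqI[OF that(1) h]) (use that(2) eq unit_vec_ell2 in fastforce)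
  have "adjoint_on (ell2 U) S y = h"
    unfolding adjoint_on_def by (rule the_equality) (use h eq uniq in blast)+
  then show ?thesis
    using uniq[OF k] eq by blast
qed

text \<open>P leaves each eigenspace of the diagonal operator invariant, and vectors in different
  eigenspaces have disjoint supports.\<close>

lemma commuting_block_diagonal:
  assumes P: "P \<in> commutant (ell2 D) (opD lam)"
  shows "block_diagonal (eigenspaces (ell2 D) (opD lam)) P"
proof -
  have "ip (P f) g = 0"
    if f: "f \<in> eigen_ker (ell2 D) (opD lam) z" and g: "g \<in> eigen_ker (ell2 D) (opD lam) z'"
      and "z \<noteq> z'" for f g z z'
  proof (rule ip_eq_0)
    fix v
    have fD: "f \<in> ell2 D" and Df: "opD lam f = (\<lambda>v. z * f v)"
      using f by (auto simp: eigen_ker_def fun_eq_iff)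
    have B: "P \<in> bounded_ops (ell2 D) (ell2 D)"
      using P by (simp add: commutant_def)
    have "opD lam (P f) = P (opD lam f)"
      using P fD by (simp add: commutant_def)
    also have "\<dots> = (\<lambda>v. z * P f v)"
      by (simp only: Df bounded_ops_scale[OF B fD])
    finally have "lam (Some v) * P f v = z * P f v"
      by (simp add: opD_def fun_eq_iff)
    moreover have "lam (Some v) * g v = z' * g v"
      using g by (simp add: eigen_ker_def opD_def fun_eq_iff)
    ultimately show "P f v * cnj (g v) = 0"
      using \<open>z \<noteq> z'\<close> by auto
  qed
  then show ?thesis
    unfolding block_diagonal_def eigenspaces_def by blast
qed

section \<open>The commutant of a diagonal operator plus an orthogonal rank-one operator\<close>

text \<open>Writing D also for the diagonal operator on \<open>\<ell>\<^sup>2(D)\<close>, this is \<open>W = D \<oplus> N\<close> on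
  \<open>\<ell>\<^sup>2(D) \<oplus> \<ell>\<^sup>2(V - D)\<close> with D injective and \<open>N = e\<^sub>u \<otimes> a \<noteq> 0\<close>.  The normalisation of the coordinate of a at u makes \<open>\<lambda>\<^sub>u\<^sub>u\<close> the eigenvalue of N
  at \<open>e\<^sub>u\<close>, which is how the spectral condition on the off-diagonal blocks arises.\<close>

locale diagonal_plus_rank_one =
  fixes V D :: "'v set" and u :: 'v and lam :: "'v option \<Rightarrow> complex" and a :: "'v \<Rightarrow> complex"
    and W :: "('v \<Rightarrow> complex) \<Rightarrow> ('v \<Rightarrow> complex)"
  assumes D_sub: "D \<subseteq> V" and u_mem: "u \<in> V - D"
    and a_mem: "a \<in> ell2 (V - D)" and a_u: "cnj (a u) = lam (Some u)" and a_ne: "a \<noteq> (\<lambda>v. 0)"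
    and lam_ne: "\<And>v. v \<in> D \<Longrightarrow> lam (Some v) \<noteq> 0"
    and diag: "\<And>f. f \<in> ell2 D \<Longrightarrow> opD lam f \<in> ell2 D"
    and W_eq: "\<And>f. f \<in> ell2 V \<Longrightarrow>
      W f = (\<lambda>w. opD lam (restr D f) w + rank_one (unit_vec u) a f w)"
begin

lemma W_apply:
  "f \<in> ell2 V \<Longrightarrow>
    W f w = (if w \<in> D then lam (Some w) * f w else if w = u then ip f a else 0)"
  using u_mem by (auto simp: W_eq opD_def restr_def rank_one_def unit_vec_def)

lemma a_outside: "v \<in> D \<Longrightarrow> a v = 0"
  using a_mem by (simp add: ell2_iff)

lemma ip_unit_u_a: "ip (unit_vec u) a = lam (Some u)"
  by (simp add: ip_unit_left a_u)

lemma ip_a_restr: "ip (restr (V - D) f) a = ip f a"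
  by (rule ip_cong) (use a_mem in \<open>auto simp: restr_def ell2_iff\<close>)

lemma W_on_D: "f \<in> ell2 D \<Longrightarrow> W f = opD lam f"
  using ip_eq_0[of f a] a_outside ell2_mono[OF _ D_sub, of f]
  by (fastforce simp: fun_eq_iff W_apply opD_def ell2_iff)

lemma W_off_D: 
  assumes g: "g \<in> ell2 (V - D)"
  shows "W g = (\<lambda>v. ip g a * unit_vec u v)"
proof -
  have "g \<in> ell2 V" using g by (rule ell2_mono) auto
  moreover have "g w = 0" if "w \<in> D" for w using that g by (simp add: ell2_iff)
  ultimately show ?thesis
    using u_mem by (auto simp: W_apply unit_vec_def)
qed

text \<open>Write X as a block matrix \<open>(P, Q; R, S)\<close>.  Commuting with \<open>D \<oplus> N\<close> means \<open>PD = DP\<close>,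
  \<open>QN = DQ\<close>, \<open>RD = NR\<close> and \<open>SN = NS\<close>.

  \<^item> \<open>DQ g = \<langle>g, a\<rangle> Q e\<^sub>u\<close> depends on g only through \<open>\<langle>g, a\<rangle>\<close>; as D is injective, so does
    \<open>Q g\<close>, whence \<open>Q = f\<^sub>0 \<otimes> a\<close>, and \<open>g = e\<^sub>u\<close>, \<open>g = a\<close> give \<open>D f\<^sub>0 = \<lambda>\<^sub>u\<^sub>u f\<^sub>0\<close>.
  \<^item> \<open>\<lambda>\<^sub>u\<^sub>v R e\<^sub>v = N R e\<^sub>v\<close> is a multiple of \<open>e\<^sub>u\<close>.  As \<open>\<lambda>\<^sub>u\<^sub>v \<noteq> 0\<close>, so too is \<open>R e\<^sub>v\<close>, and since
    \<open>N e\<^sub>u = \<lambda>\<^sub>u\<^sub>u e\<^sub>u\<close> it vanishes unless \<open>\<lambda>\<^sub>u\<^sub>v = \<lambda>\<^sub>u\<^sub>u\<close>.  Boundedness of R passes these facts from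
    basis vectors to all vectors.
  \<^item> \<open>\<langle>g, a\<rangle> S e\<^sub>u = \<langle>S g, a\<rangle> e\<^sub>u\<close> says that \<open>e\<^sub>u\<close> is an eigenvector of S (take \<open>g = a\<close>) and that a is
    an eigenvector of the adjoint for the conjugate eigenvalue.\<close>

lemma commutant_imp_blocks:
  assumes X: "X \<in> commutant (ell2 V) W"
  obtains P S f\<^sub>0 \<mu> where
    "block_matrix (ell2 D) (ell2 (V - D)) X P (rank_one f\<^sub>0 a)
       (rank_one (unit_vec u) (conj_vec \<mu> {v \<in> D. lam (Some v) = lam (Some u)})) S"
    "P \<in> commutant (ell2 D) (opD lam)"
    "f\<^sub>0 \<in> eigen_ker (ell2 D) (opD lam) (lam (Some u))"
    "\<mu> \<in> ell2 D"
    "S (unit_vec u) = (\<lambda>v. ip (S (unit_vec u)) (unit_vec u) * unit_vec u v)"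
    "adjoint_on (ell2 (V - D)) S a = (\<lambda>v. cnj (ip (S (unit_vec u)) (unit_vec u)) * a v)"
proof -
  have B: "X \<in> bounded_ops (ell2 V) (ell2 V)" and comm: "\<And>f. f \<in> ell2 V \<Longrightarrow> X (W f) = W (X f)"
    using X by (auto simp: commutant_def)
  note add = bounded_ops_add[OF B] and scale = bounded_ops_scale[OF B]
    and maps = bounded_ops_maps[OF B]
  have sub1: "f \<in> ell2 V" if "f \<in> ell2 D" for f
    using that D_sub by (rule ell2_mono)
  have sub2: "f \<in> ell2 V" if "f \<in> ell2 (V - D)" for f
    using that by (rule ell2_mono) auto
  have uK: "unit_vec u \<in> ell2 (V - D)"
    using u_mem by (rule unit_vec_ell2)
  note uV = sub2[OF uK] and aV = sub2[OF a_mem]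
  have aa: "ip a a \<noteq> 0"
    using a_mem a_ne by (rule ip_self_ne_0)
  define P where "P = (\<lambda>f. restr D (X f))"
  define S where "S = (\<lambda>f. restr (V - D) (X f))"
  define f\<^sub>0 where "f\<^sub>0 = (\<lambda>v. inverse (ip a a) * restr D (X a) v)"
  define s where "s = X (unit_vec u) u"
  have PB: "P \<in> bounded_ops (ell2 D) (ell2 D)"
    unfolding P_def by (rule bounded_ops_compress[OF B D_sub])
  have SB: "S \<in> bounded_ops (ell2 (V - D)) (ell2 (V - D))"
    unfolding S_def by (rule bounded_ops_compress[OF B]) auto

  \<comment> \<open>The equations \<open>QN = DQ\<close> (for w in D) and \<open>SN = NS\<close> (for w outside D) in coordinates.\<close>
  have offdiag: "ip g a * X (unit_vec u) w = W (X g) w" if "g \<in> ell2 (V - D)" for g w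
    using comm[OF sub2[OF that]] by (simp add: W_off_D[OF that] scale[OF uV] fun_eq_iff)

  have f0D: "f\<^sub>0 \<in> ell2 D"
    unfolding f\<^sub>0_def by (rule ell2_scale[OF restr_ell2[OF maps[OF aV]]])
  have Q: "X g v = ip g a * f\<^sub>0 v" if g: "g \<in> ell2 (V - D)" and v: "v \<in> D" for g v
  proof -
    have 1: "lam (Some v) * X g v = ip g a * X (unit_vec u) v"
      using offdiag[OF g, of v] v by (simp add: W_apply maps sub2 g)
    have 2: "lam (Some v) * X a v = ip a a * X (unit_vec u) v"
      using offdiag[OF a_mem, of v] v by (simp add: W_apply maps aV)
    have "lam (Some v) * (ip a a * X g v) = lam (Some v) * (ip g a * X a v)"
      using 1 2 by (metis mult.left_commute)
    then have "ip a a * X g v = ip g a * X a v"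
      using lam_ne[OF v] by simp
    then show ?thesis
      using aa v by (simp add: f\<^sub>0_def restr_def field_simps)
  qed
  have f0: "f\<^sub>0 \<in> eigen_ker (ell2 D) (opD lam) (lam (Some u))"
  proof -
    have "lam (Some v) * f\<^sub>0 v = lam (Some u) * f\<^sub>0 v" for v
    proof (cases "v \<in> D")
      case True
      have "lam (Some v) * X a v = ip a a * (lam (Some u) * f\<^sub>0 v)"
        using offdiag[OF a_mem, of v] True Q[OF uK True]
        by (simp add: W_apply maps aV ip_unit_u_a)
      then show ?thesis
        using Q[OF a_mem True] aa by simp
    next
      case False
      then show ?thesis using f0D by (simp add: ell2_iff)
    qed
    then show ?thesis
      using f0D by (simp add: eigen_ker_def opD_def fun_eq_iff)
  qed

  \<comment> \<open>Every coordinate of X on \<open>\<ell>\<^sup>2(D)\<close> is an inner product, hence is determined by the vectors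
    \<open>X e\<^sub>v\<close> with v in D.\<close>
  have Riesz: "\<exists>h\<in>ell2 D. \<forall>f\<in>ell2 D. X f w = ip f h" for w
  proof -
    obtain h where "h \<in> ell2 D"
      "\<And>f. f \<in> ell2 D \<Longrightarrow> ip (restr UNIV (X f)) (unit_vec w) = ip f h"
      using Riesz_bounded_op[OF bounded_ops_compress[OF B D_sub, of UNIV] unit_vec_ell2[of w UNIV]]
      by auto
    then show ?thesis by (auto simp: ip_unit_right restr_def)
  qed
  have eigvec: "lam (Some v) * X (unit_vec v) w = W (X (unit_vec v)) w" if "v \<in> D" for v w
  proof -
    have e: "unit_vec v \<in> ell2 D" using that by (rule unit_vec_ell2)
    have "W (unit_vec v) = (\<lambda>w. lam (Some v) * unit_vec v w)"
      unfolding W_on_D[OF e] by (auto simp: opD_def unit_vec_def)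
    then show ?thesis
      using comm[OF sub1[OF e]] scale[OF sub1[OF e], of "lam (Some v)"] by metis
  qed
  have only_u: "X f w = 0" if f: "f \<in> ell2 D" and w: "w \<notin> D" "w \<noteq> u" for f w
  proof -
    obtain h where h: "h \<in> ell2 D" "\<And>f. f \<in> ell2 D \<Longrightarrow> X f w = ip f h"
      using Riesz by blast
    have "h v = 0" for v
    proof (cases "v \<in> D")
      case True
      have e: "unit_vec v \<in> ell2 D" using True by (rule unit_vec_ell2)
      have "lam (Some v) * X (unit_vec v) w = 0"
        using eigvec[OF True] w by (simp add: W_apply maps sub1 e)
      then show ?thesis
        using lam_ne[OF True] h(2)[OF e] by (simp add: ip_unit_left)
    qed (use h(1) in \<open>simp add: ell2_iff\<close>)
    then show ?thesis
      using h(2)[OF f] ip_eq_0[of f h] by simp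
  qed
  obtain h where h: "h \<in> ell2 D" and hX: "\<And>f. f \<in> ell2 D \<Longrightarrow> X f u = ip f h"
    using Riesz by blast
  have h_supp: "h v = 0" if v: "v \<in> D" and ne: "lam (Some v) \<noteq> lam (Some u)" for v
  proof -
    have e: "unit_vec v \<in> ell2 D" using v by (rule unit_vec_ell2)
    have "ip (X (unit_vec v)) a = X (unit_vec v) u * cnj (a u)"
      using only_u[OF e] a_outside by (subst ip_finite[of "{u}"]) auto
    then have "lam (Some v) * X (unit_vec v) u = lam (Some u) * X (unit_vec v) u"
      using eigvec[OF v, of u] u_mem by (simp add: W_apply maps sub1 e a_u mult.commute)
    then show ?thesis
      using ne hX[OF e] by (simp add: ip_unit_left)
  qed
  define \<mu> where "\<mu> = (\<lambda>v. cnj (h v))"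
  have \<mu>: "\<mu> \<in> ell2 D"
    unfolding \<mu>_def by (rule ell2_cnj[OF h])
  have h_eq: "conj_vec \<mu> {v \<in> D. lam (Some v) = lam (Some u)} = h"
    using h h_supp by (auto simp: conj_vec_def \<mu>_def ell2_iff fun_eq_iff)

  have blocks: "block_matrix (ell2 D) (ell2 (V - D)) X P (rank_one f\<^sub>0 a)
     (rank_one (unit_vec u) (conj_vec \<mu> {v \<in> D. lam (Some v) = lam (Some u)})) S"
    unfolding h_eq block_matrix_def
  proof (intro conjI ballI PB SB rank_one_bounded[OF f0D a_mem] rank_one_bounded[OF uK h])
    fix f g assume f: "f \<in> ell2 D" and g: "g \<in> ell2 (V - D)"
    have "X (\<lambda>v. f v + g v) w =
        P f w + rank_one f\<^sub>0 a g w + (rank_one (unit_vec u) h f w + S g w)" for w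
    proof (cases "w \<in> D")
      case True
      then show ?thesis
        using u_mem Q[OF g True]
        by (auto simp: add[OF sub1[OF f] sub2[OF g]] P_def S_def restr_def rank_one_def unit_vec_def)
    next
      case False
      moreover have "X f w = rank_one (unit_vec u) h f w"
        using only_u[OF f False] hX[OF f] by (auto simp: rank_one_def unit_vec_def)
      moreover have "X g w = S g w"
        using maps[OF sub2[OF g]] False by (auto simp: S_def restr_def ell2_iff)
      moreover have "f\<^sub>0 w = 0"
        using f0D False by (simp add: ell2_iff)
      ultimately show ?thesis
        by (simp add: add[OF sub1[OF f] sub2[OF g]] P_def restr_def rank_one_def)
    qed
    then show "X (\<lambda>v. f v + g v) =
        (\<lambda>v. P f v + rank_one f\<^sub>0 a g v + (rank_one (unit_vec u) h f v + S g v))"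
      by (rule ext)
  qed

  have P: "P \<in> commutant (ell2 D) (opD lam)"
  proof -
    have "P (opD lam f) = opD lam (P f)" if f: "f \<in> ell2 D" for f
    proof
      fix w
      show "P (opD lam f) w = opD lam (P f) w"
        using comm[OF sub1[OF f]]
        by (simp add: P_def restr_def opD_def[of lam "\<lambda>v. if v \<in> D then X f v else 0"]
            W_on_D[OF f] W_apply maps sub1 f)
    qed
    then show ?thesis
      using PB by (simp add: commutant_def)
  qed

  have Su: "S (unit_vec u) = (\<lambda>v. s * unit_vec u v)"
  proof
    fix w
    show "S (unit_vec u) w = s * unit_vec u w"
    proof (cases "w \<in> V - D \<and> w \<noteq> u")
      case True
      then have "ip a a * X (unit_vec u) w = 0"
        using offdiag[OF a_mem, of w] by (simp add: W_apply maps aV)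
      then show ?thesis
        using aa True by (simp add: S_def restr_def unit_vec_def)
    next
      case False
      then show ?thesis
        using u_mem by (auto simp: S_def restr_def s_def unit_vec_def)
    qed
  qed
  then have s: "ip (S (unit_vec u)) (unit_vec u) = s"
    by (simp add: ip_unit_right) (simp add: unit_vec_def)
  have "ip (S g) a = ip g (\<lambda>v. cnj s * a v)" if g: "g \<in> ell2 (V - D)" for g
    using offdiag[OF g, of u] u_mem mult.commute[of "ip g a" "X (unit_vec u) u"]
    by (simp add: S_def ip_a_restr ip_scale_right W_apply maps sub2 g s_def)
  then have "adjoint_on (ell2 (V - D)) S a = (\<lambda>v. cnj s * a v)"
    using adjoint_on_eq_iff[OF SB a_mem ell2_scale[OF a_mem]] by blast
  then show thesis
    using that[OF blocks P f0 \<mu>] Su s by simp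
qed

text \<open>The four block equations are checked from the closed forms of the blocks: the vector in
  the lower left block lives on coordinates of weight \<open>\<lambda>\<^sub>u\<^sub>u\<close>, so that pairing \<open>D f\<close> with it gives the
  factor \<open>\<lambda>\<^sub>u\<^sub>u = \<langle>e\<^sub>u, a\<rangle>\<close> that N produces.\<close>

lemma blocks_imp_commutant:
  assumes B: "X \<in> bounded_ops (ell2 V) (ell2 V)"
    and blocks: "block_matrix (ell2 D) (ell2 (V - D)) X P (rank_one f\<^sub>0 a)
       (rank_one (unit_vec u) (conj_vec \<mu> {v \<in> D. lam (Some v) = lam (Some u)})) S"
    and P: "P \<in> commutant (ell2 D) (opD lam)"
    and f0: "f\<^sub>0 \<in> eigen_ker (ell2 D) (opD lam) (lam (Some u))"
    and Su: "S (unit_vec u) = (\<lambda>v. ip (S (unit_vec u)) (unit_vec u) * unit_vec u v)"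
    and adj: "adjoint_on (ell2 (V - D)) S a =
        (\<lambda>v. cnj (ip (S (unit_vec u)) (unit_vec u)) * a v)"
  shows "X \<in> commutant (ell2 V) W"
proof -
  define s where "s = ip (S (unit_vec u)) (unit_vec u)"
  define m where "m = conj_vec \<mu> {v \<in> D. lam (Some v) = lam (Some u)}"
  have uK: "unit_vec u \<in> ell2 (V - D)"
    using u_mem by (rule unit_vec_ell2)
  have PB: "P \<in> bounded_ops (ell2 D) (ell2 D)" and SB: "S \<in> bounded_ops (ell2 (V - D)) (ell2 (V - D))"
    and X: "\<And>f g. f \<in> ell2 D \<Longrightarrow> g \<in> ell2 (V - D) \<Longrightarrow> X (\<lambda>v. f v + g v) =
      (\<lambda>v. (P f v + rank_one f\<^sub>0 a g v) + (rank_one (unit_vec u) m f v + S g v))"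
    using blocks by (auto simp: block_matrix_def m_def)
  have PD: "\<And>f. f \<in> ell2 D \<Longrightarrow> P (opD lam f) = opD lam (P f)"
    using P by (simp add: commutant_def)
  have f0D: "f\<^sub>0 \<in> ell2 D" and f0_eig: "\<And>v. lam (Some v) * f\<^sub>0 v = lam (Some u) * f\<^sub>0 v"
    using f0 by (auto simp: eigen_ker_def opD_def fun_eq_iff)
  have m_eig: "ip (opD lam f) m = lam (Some u) * ip f m" for f
    unfolding ip_scale_left[symmetric]
    by (rule ip_cong) (auto simp: m_def conj_vec_def opD_def)
  have Sa: "ip (S g) a = s * ip g a" if "g \<in> ell2 (V - D)" for g
    using adj that unfolding s_def[symmetric]
    by (simp add: adjoint_on_eq_iff[OF SB a_mem ell2_scale[OF a_mem]] ip_scale_right)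
  have "X (W f) w = W (X f) w" if f: "f \<in> ell2 V" for f w
  proof -
    define f1 where "f1 = restr D f"
    define f2 where "f2 = restr (V - D) f"
    have f1: "f1 \<in> ell2 D" and f2: "f2 \<in> ell2 (V - D)"
      using f by (auto simp: f1_def f2_def restr_ell2)
    have f_split: "f = (\<lambda>v. f1 v + f2 v)"
      using f D_sub by (auto simp: f1_def f2_def restr_def ell2_iff fun_eq_iff)
    have ipa: "ip f a = ip f2 a"
      by (simp add: f2_def ip_a_restr)
    have cu: "(\<lambda>v. c * unit_vec u v) \<in> ell2 (V - D)" for c
      by (rule ell2_scale[OF uK])
    have Wf: "W f = (\<lambda>v. opD lam f1 v + ip f2 a * unit_vec u v)"
      by (simp add: W_eq[OF f] f1_def[symmetric] rank_one_def ipa)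
    have SeU: "S (\<lambda>v. c * unit_vec u v) = (\<lambda>v. c * (s * unit_vec u v))" for c
      unfolding bounded_ops_scale[OF SB uK] using Su unfolding s_def[symmetric] by simp
    have XW: "X (W f) w = lam (Some w) * P f1 w + ip f2 a * (lam (Some u) * f\<^sub>0 w)
        + (lam (Some u) * ip f1 m * unit_vec u w + ip f2 a * (s * unit_vec u w))"
      unfolding Wf X[OF diag[OF f1] cu] PD[OF f1] SeU
      by (simp add: opD_def[of lam "P f1"] rank_one_def m_eig ip_scale_left ip_unit_u_a)
    have Xf: "X f = (\<lambda>v. (P f1 v + ip f2 a * f\<^sub>0 v) + (ip f1 m * unit_vec u v + S f2 v))"
      unfolding f_split X[OF f1 f2] by (simp add: rank_one_def)
    have Pf: "P f1 \<in> ell2 D" and Sf: "S f2 \<in> ell2 (V - D)"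
      using bounded_ops_maps[OF PB f1] bounded_ops_maps[OF SB f2] by auto
    have XfV: "X f \<in> ell2 V"
      by (rule bounded_ops_maps[OF B f])
    have "ip (X f) a = ip (\<lambda>v. ip f1 m * unit_vec u v + S f2 v) a"
    proof (rule ip_cong)
      show "X f v * cnj (a v) = (ip f1 m * unit_vec u v + S f2 v) * cnj (a v)" for v
        by (cases "v \<in> D")
          (simp_all add: Xf a_outside ell2_outside[OF Pf] ell2_outside[OF f0D])
    qed
    also have "\<dots> = ip f1 m * lam (Some u) + s * ip f2 a"
      by (simp add: ip_add_left[OF cu Sf a_mem] ip_scale_left ip_unit_u_a Sa[OF f2])
    finally have Xa: "ip (X f) a = ip f1 m * lam (Some u) + s * ip f2 a" .
    consider "w \<in> D" | "w = u" | "w \<notin> D" "w \<noteq> u" by blast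
    then show ?thesis
    proof cases
      case 1
      then have "unit_vec u w = 0" "S f2 w = 0"
        using u_mem Sf by (auto simp: unit_vec_def ell2_iff)
      then have "X f w = P f1 w + ip f2 a * f\<^sub>0 w"
        by (simp add: Xf)
      then show ?thesis
        using 1 \<open>unit_vec u w = 0\<close> f0_eig[of w]
        by (auto simp: XW W_apply[OF XfV] distrib_left mult.left_commute)
    next
      case 2
      then have "P f1 w = 0" "f\<^sub>0 w = 0" "unit_vec u w = 1"
        using u_mem Pf f0D by (auto simp: unit_vec_def ell2_iff)
      then show ?thesis
        unfolding XW using 2 u_mem by (simp add: W_apply[OF XfV] Xa mult.commute)
    next
      case 3
      then have "P f1 w = 0" "f\<^sub>0 w = 0" "unit_vec u w = 0"
        using Pf f0D by (auto simp: unit_vec_def ell2_iff)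
      then show ?thesis
        using 3 by (simp add: XW W_apply[OF XfV])
    qed
  qed
  then show ?thesis
    using B by (auto simp: commutant_def)
qed

end

section \<open>Ancestors and the join with a base point\<close>

locale rooted_tree =
  fixes V :: "'v set" and E :: "('v \<times> 'v) set"
  assumes tree: "rooted_directed_tree V E"
begin

lemma edges: "E \<subseteq> V \<times> V" and acyclic_E: "acyclic E"
  using tree by (auto simp: rooted_directed_tree_def directed_tree_def)

lemma parent_unique:
  assumes "(w, v) \<in> E" "(w', v) \<in> E"
  shows "w = w'"
proof -
  have "v \<in> V" "\<not> is_root V E v"
    using assms edges by (auto simp: is_root_def)
  then have "\<exists>!w. (w, v) \<in> E"
    using tree by (auto simp: rooted_directed_tree_def directed_tree_def)
  then show ?thesis
    using assms by blast
qed

lemma root_is_root: "is_root V E (root_of V E)"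
  unfolding root_of_def
  using tree theI'[of "is_root V E"] by (simp add: rooted_directed_tree_def)

lemma no_edge_into_root: "(w, root_of V E) \<notin> E"
  using root_is_root by (auto simp: is_root_def)

text \<open>The descendants of the root are closed under passing to children and to parents, so
  connectedness leaves no other vertices.\<close>

lemma root_reaches:
  assumes "v \<in> V"
  shows "(root_of V E, v) \<in> E\<^sup>*"
proof -
  have "(root_of V E, v) \<in> (E \<union> E\<inverse>)\<^sup>*"
    using tree root_is_root assms
    by (auto simp: rooted_directed_tree_def directed_tree_def is_root_def)
  then show ?thesis
  proof (induction rule: rtrancl_induct)
    case (step y z)
    show ?case
    proof (cases "(y, z) \<in> E")
      case False
      \<comment> \<open>The walk goes up from y to its parent z; by uniqueness of parents z is the last vertex
        before y on the directed path from the root to y.\<close>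
      then have zy: "(z, y) \<in> E"
        using step.hyps(2) by auto
      from step.IH show ?thesis
      proof (cases rule: rtranclE)
        case base
        then show ?thesis using zy no_edge_into_root by blast
      next
        case (step x)
        then show ?thesis using zy parent_unique by blast
      qed
    qed (use step.IH in auto)
  qed auto
qed

lemma descendant_in_V: "(x, y) \<in> E\<^sup>* \<Longrightarrow> x \<in> V \<Longrightarrow> y \<in> V"
  by (induction rule: rtrancl_induct) (use edges in auto)

lemma descendant_antisym: "(x, y) \<in> E\<^sup>* \<Longrightarrow> (y, x) \<in> E\<^sup>* \<Longrightarrow> x = y"
  using acyclic_E by (meson acyclic_impl_antisym_rtrancl antisymD)

text \<open>Unique parents make the reversed edge relation single-valued, and the ancestors of z are the
  points of one orbit.\<close>

lemma ancestors_comparable: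
  assumes "(x, z) \<in> E\<^sup>*" "(y, z) \<in> E\<^sup>*"
  shows "(x, y) \<in> E\<^sup>* \<or> (y, x) \<in> E\<^sup>*"
proof -
  have "single_valued (E\<inverse>)"
    by (auto simp: single_valued_def intro: parent_unique)
  from single_valued_confluent[OF this] show ?thesis
    using assms by (metis converse_iff rtrancl_converse)
qed

lemma Asc_iff: "w \<in> Asc E v \<longleftrightarrow> (w, v) \<in> E\<^sup>* \<and> w \<noteq> v"
proof -
  have "w \<in> Asc E v \<longleftrightarrow> (w, v) \<in> E\<^sup>+"
    unfolding Asc_def trancl_power by (simp add: Suc_le_eq)
  also have "\<dots> \<longleftrightarrow> (w, v) \<in> E\<^sup>* \<and> w \<noteq> v"
    using acyclic_E by (auto simp: rtrancl_eq_or_trancl acyclic_def)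
  finally show ?thesis .
qed

lemma Asc_subset: "Asc E v \<subseteq> V"
proof
  fix w assume "w \<in> Asc E v"
  then have "(w, v) \<in> E\<^sup>*" "w \<noteq> v" by (auto simp: Asc_iff)
  then show "w \<in> V"
    by (cases rule: converse_rtranclE) (use edges in auto)
qed

text \<open>Each edge on the path from the root to v adds one ancestor.  This is what makes
  \<open>setA E b u\<close> finite and the vector \<open>vecA E b u lam\<close> square-summable.\<close>

lemma finite_ancestors:
  assumes "v \<in> V"
  shows "finite {w. (w, v) \<in> E\<^sup>*}"
  using root_reaches[OF assms]
proof (induction rule: rtrancl_induct)
  case base
  have "{w. (w, root_of V E) \<in> E\<^sup>*} \<subseteq> {root_of V E}"
    using no_edge_into_root by (auto elim: rtranclE)
  then show ?case by (rule finite_subset) auto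
next
  case (step y z)
  have "{w. (w, z) \<in> E\<^sup>*} \<subseteq> insert z {w. (w, y) \<in> E\<^sup>*}"
    using step.hyps(2) by (blast elim: rtranclE dest: parent_unique)
  then show ?case by (rule finite_subset) (simp add: step.IH)
qed

lemma root_path_length_unique:
  "(root_of V E, v) \<in> E ^^ n \<Longrightarrow> (root_of V E, v) \<in> E ^^ m \<Longrightarrow> m = n"
proof (induction n arbitrary: v m)
  case 0
  then show ?case using no_edge_into_root by (cases m) auto
next
  case (Suc n)
  obtain p where p: "(root_of V E, p) \<in> E ^^ n" "(p, v) \<in> E"
    using Suc.prems(1) by auto
  then obtain k where "m = Suc k"
    using Suc.prems(2) no_edge_into_root by (cases m) auto
  then obtain q where "(root_of V E, q) \<in> E ^^ k" "(q, v) \<in> E"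
    using Suc.prems(2) by auto
  then show ?case
    using p Suc.IH[of p k] parent_unique \<open>m = Suc k\<close> by auto
qed

lemma depth_eq: "(root_of V E, v) \<in> E ^^ n \<Longrightarrow> depth V E v = n"
  unfolding depth_def by (rule the_equality) (auto intro: root_path_length_unique)

lemma depth_less:
  assumes "w \<in> Asc E v"
  shows "depth V E w < depth V E v"
proof -
  obtain k where k: "k \<ge> 1" "(w, v) \<in> E ^^ k"
    using assms by (auto simp: Asc_def)
  obtain n where n: "(root_of V E, w) \<in> E ^^ n"
    using root_reaches[of w] assms Asc_subset by (auto simp: rtrancl_power)
  have "(root_of V E, v) \<in> E ^^ (n + k)"
    unfolding relpow_add using n k(2) by auto
  then show ?thesis
    using depth_eq n k(1) by fastforce
qed

lemma common_ancestor_iff: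
  "(\<exists>m n. (w, x) \<in> E ^^ n \<and> (w, y) \<in> E ^^ m) \<longleftrightarrow> (w, x) \<in> E\<^sup>* \<and> (w, y) \<in> E\<^sup>*"
  by (auto simp: rtrancl_power)

text \<open>Every common ancestor of x and y is an ancestor of x or x itself, and depth strictly increases
  along descents, so x is the unique common ancestor of largest depth.\<close>

lemma meet_ancestor:
  assumes xy: "(x, y) \<in> E\<^sup>*" and x: "x \<in> V"
  shows "meet V E x y = x" "meet V E y x = x"
proof -
  let ?P = "\<lambda>w. w \<in> V \<and> (w, x) \<in> E\<^sup>* \<and> (w, y) \<in> E\<^sup>*"
  have "arg_max (depth V E) ?P = x"
    unfolding arg_max_def
  proof (rule some_equality)
    show "is_arg_max (depth V E) ?P x"
      using assms depth_less by (fastforce simp: is_arg_max_def Asc_iff)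
  next
    fix w assume "is_arg_max (depth V E) ?P w"
    then show "w = x"
      using assms depth_less[of w x] by (auto simp: is_arg_max_def Asc_iff)
  qed
  then show "meet V E x y = x" "meet V E y x = x"
    unfolding meet_def common_ancestor_iff by (simp_all add: conj_commute conj_left_commute)
qed

lemma Des_ext_iff:
  "Some x \<in> Des (ext_edges V E) (Some y) \<longleftrightarrow> (y, x) \<in> E\<^sup>*"
proof
  have "(case q of None \<Rightarrow> True | Some x \<Rightarrow> (y, x) \<in> E\<^sup>*)"
    if "(Some y, q) \<in> (ext_edges V E)\<^sup>*" for q
    using that by (induction rule: rtrancl_induct) (auto simp: ext_edges_def split: option.splits)
  from this[of "Some x"] show "Some x \<in> Des (ext_edges V E) (Some y) \<Longrightarrow> (y, x) \<in> E\<^sup>*"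
    by (simp add: Des_def)
next
  assume "(y, x) \<in> E\<^sup>*"
  then have "(Some y, Some x) \<in> (ext_edges V E)\<^sup>*"
    by (induction rule: rtrancl_induct) (auto simp: ext_edges_def intro: rtrancl_into_rtrancl)
  then show "Some x \<in> Des (ext_edges V E) (Some y)"
    by (simp add: Des_def)
qed

lemma join_eq:
  "join V E (Some x) (Some y) =
     (if (y, x) \<in> E\<^sup>* then Some x else if (x, y) \<in> E\<^sup>* then Some y else None)"
  by (simp add: join_def Des_ext_iff)

lemma suppH_setA_subset:
  assumes "u \<in> V" "b \<in> V"
  shows "suppH E b u \<subseteq> V" "setA E b u \<subseteq> V - suppH E b u"
  using assms Asc_subset descendant_in_V descendant_antisym
  by (auto simp: suppH_def setA_def Des_off_def Des_def path_verts_def Asc_iff)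

lemma u_in_setA: "u \<in> setA E b u"
  by (auto simp: setA_def path_verts_def Des_def)

lemma finite_setA:
  assumes "u \<in> V" "b \<in> V"
  shows "finite (setA E b u)"
proof -
  have "setA E b u \<subseteq> insert b ({w. (w, u) \<in> E\<^sup>*} \<union> {w. (w, b) \<in> E\<^sup>*})"
    by (auto simp: setA_def path_verts_def Des_def Asc_iff)
  then show ?thesis
    by (rule finite_subset) (simp add: finite_ancestors assms)
qed

text \<open>If b is a descendant of u, then u is an ancestor of b.  On the ancestors of b, which
  form a chain, the join with u is the meet: an ancestor of u is kept, a vertex of \<open>[u,b]\<close> is sent to
  u, and so is b by its own clause.  The remaining descendants of u are kept, everything else goes to infinity.  If b is not a
  descendant of u, then only the clause for \<open>v = b\<close> differs from the plain join.\<close>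

lemma join_at_eq:
  assumes u: "u \<in> V" and b: "b \<in> V - {u}" and v: "v \<in> V"
  shows "join_at V E b (Some u) (Some v) =
    (if v \<in> suppH E b u then Some v else if v \<in> setA E b u then Some u else None)"
proof (cases "(u, b) \<in> E\<^sup>*")
  case True
  then have uA: "u \<in> Asc E b" using b by (auto simp: Asc_iff)
  have supp: "v \<in> suppH E b u \<longleftrightarrow> v \<in> Asc E u \<or> ((u, v) \<in> E\<^sup>* \<and> (v, b) \<notin> E\<^sup>*)"
    and A: "v \<in> setA E b u \<longleftrightarrow> (u, v) \<in> E\<^sup>* \<and> (v, b) \<in> E\<^sup>*"
    using True by (auto simp: suppH_def setA_def Des_off_def Des_def path_verts_def)
  show ?thesis
  proof (cases "v \<in> Asc E b")
    case vA: True
    then have "(v, u) \<in> E\<^sup>* \<or> (u, v) \<in> E\<^sup>*"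
      using True ancestors_comparable by (auto simp: Asc_iff)
    then show ?thesis
    proof
      assume "(v, u) \<in> E\<^sup>*"
      then show ?thesis
        using uA vA v meet_ancestor(2)[of v u] u_in_setA[of u b]
        by (cases "v = u") (auto simp: join_at_def supp A Asc_iff)
    next
      assume uv: "(u, v) \<in> E\<^sup>*"
      then have "v \<notin> Asc E u" using descendant_antisym by (auto simp: Asc_iff)
      then show ?thesis
        using uA vA u uv meet_ancestor(1)[of u v] by (auto simp: join_at_def supp A Asc_iff)
    qed
  next
    case vA: False
    have "v \<notin> Asc E u"
      using vA True b by (auto simp: Asc_iff dest: rtrancl_trans)
        (meson descendant_antisym rtrancl_trans)
    moreover have "(v, u) \<notin> E\<^sup>*"
      using vA True \<open>v \<notin> Asc E u\<close> uA by (auto simp: Asc_iff)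
    ultimately show ?thesis
      using vA True b by (auto simp: join_at_def join_eq supp A Asc_iff)
  qed
next
  case False
  then have "u \<notin> Asc E b" by (simp add: Asc_iff)
  moreover have "v \<in> suppH E b u \<longleftrightarrow> (u, v) \<in> E\<^sup>* \<and> v \<noteq> u"
    using False descendant_antisym
    by (auto simp: suppH_def Des_off_def Des_def path_verts_def)
  moreover have "v \<in> setA E b u \<longleftrightarrow> v \<in> Asc E u \<or> v = b \<or> v = u"
    using False by (auto simp: setA_def Des_def)
  ultimately show ?thesis
    using False b descendant_antisym by (auto simp: join_at_def join_eq Asc_iff)
qed

text \<open>The fibre of \<open>v \<mapsto> u \<squnion>\<^sub>b v\<close> over a point w of the support is \<open>{w}\<close>, the one over u is
  \<open>setA E b u\<close>, and all others are empty.\<close>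

lemma wjoin_eq:
  assumes u: "u \<in> V" and b: "b \<in> V - {u}" and f: "f \<in> ell2 V"
  shows "wjoin V E b u lam f =
    (\<lambda>w. opD lam (restr (suppH E b u) f) w + opN E b u lam f w)"
proof
  fix w
  let ?I = "{v \<in> V. join_at V E b (Some u) (Some v) = Some w}"
  have bV: "b \<in> V" using b by simp
  note sub = suppH_setA_subset[OF u bV]
  have ipA: "ip f (vecA E b u lam) = (\<Sum>v\<in>setA E b u. lam (Some v) * f v)"
    unfolding vecA_def
    by (subst ip_finite[OF finite_setA[OF u bV]]) (auto simp: conj_vec_def mult.commute)
  consider "w \<in> suppH E b u" | "w = u" | "w \<notin> suppH E b u" "w \<noteq> u" by blast
  then show "wjoin V E b u lam f w = opD lam (restr (suppH E b u) f) w + opN E b u lam f w"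
  proof cases
    case 1
    then have "?I = {w}" "w \<noteq> u"
      using sub join_at_eq[OF u b] u_in_setA[of u b] by (auto split: if_splits)
    then show ?thesis
      using 1 by (simp add: wjoin_def opD_def restr_def opN_def rank_one_def unit_vec_def)
  next
    case 2
    then have I: "?I = setA E b u"
      using sub join_at_eq[OF u b] u_in_setA[of u b] by (auto split: if_splits)
    have "w \<notin> suppH E b u"
      using 2 sub u_in_setA[of u b] by auto
    then show ?thesis
      unfolding wjoin_def I
      using 2 finite_setA[OF u bV]
      by (simp add: opD_def restr_def opN_def rank_one_def unit_vec_def ipA)
  next
    case 3
    then have I: "?I = {}"
      using sub join_at_eq[OF u b] by (auto split: if_splits)
    show ?thesis
      unfolding wjoin_def I
      using 3 by (simp add: opD_def restr_def opN_def rank_one_def unit_vec_def)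
  qed
qed

end

section \<open>The commutant of a bounded weighted join operator\<close>

theorem theorem3p19:
  fixes V :: "'v set" and E :: "('v \<times> 'v) set" and u b :: 'v
    and lam :: "'v option \<Rightarrow> complex"
    and X :: "('v \<Rightarrow> complex) \<Rightarrow> ('v \<Rightarrow> complex)"
  assumes "rooted_directed_tree V E"
    and "countable V" and "infinite V"
    and "u \<in> V" and "b \<in> V - {u}"
    and "lam None = 0"
    and "wjoin_dom V E b u lam = ell2 V"
    and "wjoin V E b u lam \<in> bounded_ops (ell2 V) (ell2 V)"
    and "op_ker (spaceH E b u) (opD lam) = {\<lambda>v. 0}"
    and "\<exists>g \<in> ominus (ell2 V) (spaceH E b u). opN E b u lam g \<noteq> (\<lambda>v. 0)"
  shows "X \<in> commutant (ell2 V) (wjoin V E b u lam) \<longleftrightarrow>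
    X \<in> bounded_ops (ell2 V) (ell2 V) \<and>
    (\<exists>P S f\<^sub>0 \<mu>.
       block_matrix (spaceH E b u) (ominus (ell2 V) (spaceH E b u)) X
         P                                               (rank_one f\<^sub>0 (vecA E b u lam))
         (rank_one (unit_vec u) (conj_vec \<mu> (setW E b u lam)))   S \<and>
       P \<in> commutant (spaceH E b u) (opD lam) \<and>
       block_diagonal (eigenspaces (spaceH E b u) (opD lam)) P \<and>
       f\<^sub>0 \<in> eigen_ker (spaceH E b u) (opD lam) (lam (Some u)) \<and>
       \<mu> \<in> ell2 (suppH E b u) \<and>
       S \<in> bounded_ops (ominus (ell2 V) (spaceH E b u)) (ominus (ell2 V) (spaceH E b u)) \<and>
       S (unit_vec u) = (\<lambda>v. ip (S (unit_vec u)) (unit_vec u) * unit_vec u v) \<and>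
       adjoint_on (ominus (ell2 V) (spaceH E b u)) S (vecA E b u lam) =
         (\<lambda>v. cnj (ip (S (unit_vec u)) (unit_vec u)) * vecA E b u lam v))"
proof -
  let ?D = "suppH E b u" and ?W = "wjoin V E b u lam" and ?a = "vecA E b u lam"
  interpret rooted_tree V E
    by unfold_locales (rule assms(1))
  have u: "u \<in> V" and b: "b \<in> V" using assms(4,5) by auto
  note sub = suppH_setA_subset[OF u b]
  have W: "?W f = (\<lambda>w. opD lam (restr ?D f) w + rank_one (unit_vec u) ?a f w)"
    if "f \<in> ell2 V" for f
    using wjoin_eq[OF u assms(5) that] by (simp add: opN_def)
  interpret diagonal_plus_rank_one V ?D u lam ?a ?W
  proof
    show "?D \<subseteq> V" by (rule sub)
    show "u \<in> V - ?D" using sub u_in_setA[of u b] by auto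
    show "?a \<in> ell2 (V - ?D)"
      unfolding vecA_def by (rule ell2_finite[OF finite_setA[OF u b] sub(2)]) (simp add: conj_vec_def)
    show "cnj (?a u) = lam (Some u)"
      using u_in_setA[of u b] by (simp add: vecA_def conj_vec_def)
    show "?a \<noteq> (\<lambda>v. 0)"
      using assms(10) ip_eq_0[of _ ?a] by (auto simp: opN_def rank_one_def)
    show "lam (Some v) \<noteq> 0" if v: "v \<in> ?D" for v
    proof
      assume "lam (Some v) = 0"
      then have "unit_vec v \<in> op_ker (spaceH E b u) (opD lam)"
        using unit_vec_ell2[OF v]
        by (auto simp: op_ker_def spaceH_def opD_def unit_vec_def)
      then have "unit_vec v v = 0"
        using assms(9) by (simp add: fun_eq_iff)
      then show False by (simp add: unit_vec_def)
    qed
    \<comment> \<open>On \<open>\<ell>\<^sup>2\<close> of the support the weighted join operator is its diagonal part, so the latter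
      inherits boundedness.\<close>
    show "opD lam f \<in> ell2 ?D" if f: "f \<in> ell2 ?D" for f
    proof -
      have fV: "f \<in> ell2 V" using f sub(1) by (rule ell2_mono)
      have "ip f ?a = 0"
        by (rule ip_eq_0) (use sub(2) ell2_outside[OF f] in \<open>auto simp: vecA_def conj_vec_def\<close>)
      then have "opD lam f = ?W f"
        by (simp add: W[OF fV] restr_id[OF f] rank_one_def)
      then have "opD lam f \<in> ell2 V"
        using bounded_ops_maps[OF assms(8) fV] by simp
      then have "(\<lambda>v. (cmod (opD lam f v))\<^sup>2) summable_on UNIV"
        by (rule ell2_summable)
      then show ?thesis
        using ell2_outside[OF f] by (simp add: ell2_iff) (simp add: opD_def)
    qed
  qed (rule W)
  have K: "ominus (ell2 V) (spaceH E b u) = ell2 (V - ?D)"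
    unfolding spaceH_def by (rule ominus_ell2[OF sub(1)])
  show ?thesis
    unfolding K unfolding spaceH_def setW_def
  proof (intro iffI conjI; (elim conjE exE)?)
    assume X: "X \<in> commutant (ell2 V) ?W"
    then show "X \<in> bounded_ops (ell2 V) (ell2 V)"
      by (simp add: commutant_def)
    from X show "\<exists>P S f\<^sub>0 \<mu>.
       block_matrix (ell2 ?D) (ell2 (V - ?D)) X P (rank_one f\<^sub>0 ?a)
         (rank_one (unit_vec u) (conj_vec \<mu> {v \<in> ?D. lam (Some v) = lam (Some u)})) S \<and>
       P \<in> commutant (ell2 ?D) (opD lam) \<and>
       block_diagonal (eigenspaces (ell2 ?D) (opD lam)) P \<and>
       f\<^sub>0 \<in> eigen_ker (ell2 ?D) (opD lam) (lam (Some u)) \<and>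
       \<mu> \<in> ell2 ?D \<and>
       S \<in> bounded_ops (ell2 (V - ?D)) (ell2 (V - ?D)) \<and>
       S (unit_vec u) = (\<lambda>v. ip (S (unit_vec u)) (unit_vec u) * unit_vec u v) \<and>
       adjoint_on (ell2 (V - ?D)) S ?a = (\<lambda>v. cnj (ip (S (unit_vec u)) (unit_vec u)) * ?a v)"
    proof (rule commutant_imp_blocks, intro exI conjI)
      fix P S f\<^sub>0 \<mu>
      assume P: "P \<in> commutant (ell2 ?D) (opD lam)"
        and bm: "block_matrix (ell2 ?D) (ell2 (V - ?D)) X P (rank_one f\<^sub>0 ?a)
         (rank_one (unit_vec u) (conj_vec \<mu> {v \<in> ?D. lam (Some v) = lam (Some u)})) S"
      show "block_diagonal (eigenspaces (ell2 ?D) (opD lam)) P"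
        using P by (rule commuting_block_diagonal)
      show "S \<in> bounded_ops (ell2 (V - ?D)) (ell2 (V - ?D))"
        using bm by (simp add: block_matrix_def)
    qed
  next
    fix P S f\<^sub>0 \<mu>
    assume "X \<in> bounded_ops (ell2 V) (ell2 V)"
      and "block_matrix (ell2 ?D) (ell2 (V - ?D)) X P (rank_one f\<^sub>0 ?a)
         (rank_one (unit_vec u) (conj_vec \<mu> {v \<in> ?D. lam (Some v) = lam (Some u)})) S"
      and "P \<in> commutant (ell2 ?D) (opD lam)"
      and "f\<^sub>0 \<in> eigen_ker (ell2 ?D) (opD lam) (lam (Some u))"
      and "S (unit_vec u) = (\<lambda>v. ip (S (unit_vec u)) (unit_vec u) * unit_vec u v)"
      and "adjoint_on (ell2 (V - ?D)) S ?a = (\<lambda>v. cnj (ip (S (unit_vec u)) (unit_vec u)) * ?a v)"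
    then show "X \<in> commutant (ell2 V) ?W"
      by (rule blocks_imp_commutant)
  qed
qed

end
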